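(* Let $\mathcal{P}\subset\mathbb{R}^2$ be a finite point set which is proper 2-dimensional up to a constant factor $C$. Moreover, let $0<c<1$ be arbitrary. Then $$\#\{\phi:\mathbb{R}^2\rightarrow\mathbb{R}^2 \text{ affine}\;;\; |\phi(\mathcal{P})\cap\mathcal{P}|\ge c|\mathcal{P}|\}\ \le\ C^*\cdot|\mathcal{P}|,$$ where $C^*=C^*(C,c)$ does not depend on $|\mathcal{P}|$.
   Context: Here "affine" means an element of the affine group of $\mathbb{R}^2$, i.e. a mapping $\phi(x,y)=(a_1x+b_1y+c_1,\ a_2x+b_2y+c_2)$ with real coefficients and $a_1b_2-a_2b_1\ne0$. A set of $N$ points in $\mathbb{R}^d$ is called proper $d$-dimensional up to a constant factor $C$ if it can be cut into singletons by at most $C N^{1/d}$ appropriate hyperplanes; that is, there is a set of at most $C N^{1/d}$ hyperplanes such that the points lie in pairwise distinct open cells (connected components of the complement of the union of the hyperplanes). For $d=2$ the hyperplanes are straight lines and their number is at most $C\sqrt{N}$.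
   Formalization: For small P there can be infinitely many such affine maps (e.g. P a single point), so the bound fails. Proved: the set of maps is finite when |P| ≥ N0(C,c), and for every P for which it is finite its size is at most C*|P|, with C* depending only on C and c. *)

theory Defs
  imports "HOL-Analysis.Analysis"
begin

definition hyperplane :: "'a::euclidean_space set \<Rightarrow> bool" where
  "hyperplane h \<longleftrightarrow> (\<exists>a b. a \<noteq> 0 \<and> h = {x. a \<bullet> x = b})"

text \<open>The points lie on none of the members of \<open>H\<close>, and distinct points lie in distinct
  connected components of the complement of the union of \<open>H\<close>. The first conjunct matters:
  \<^const>\<open>connected_component_set\<close> is empty, hence not a component, at points outside the set.\<close>

definition cuts_into_singletons :: "'a::euclidean_space set set \<Rightarrow> 'a set \<Rightarrow> bool" where
  "cuts_into_singletons H P \<longleftrightarrow>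
     P \<subseteq> - \<Union>H \<and> inj_on (connected_component_set (- \<Union>H)) P"

text \<open>The dimension \<open>d\<close> is that of the ambient type, \<open>DIM('a)\<close>.\<close>

definition proper_dimensional :: "real \<Rightarrow> 'a::euclidean_space set \<Rightarrow> bool" where
  "proper_dimensional C P \<longleftrightarrow> finite P \<and>
     (\<exists>H. finite H \<and> (\<forall>h\<in>H. hyperplane h) \<and>
          real (card H) \<le> C * real (card P) powr (1 / real DIM('a)) \<and>
          cuts_into_singletons H P)"

definition affine_map :: "(real^2 \<Rightarrow> real^2) \<Rightarrow> bool" where
  "affine_map \<phi> \<longleftrightarrow> (\<exists>a1 b1 c1 a2 b2 c2.
     a1 * b2 - a2 * b1 \<noteq> 0 \<and>
     (\<forall>v. \<phi> v = vector [a1 * v$1 + b1 * v$2 + c1, a2 * v$1 + b2 * v$2 + c2]))"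

definition rich_affine_maps :: "real \<Rightarrow> (real^2) set \<Rightarrow> (real^2 \<Rightarrow> real^2) set" where
  "rich_affine_maps c P =
     {\<phi>. affine_map \<phi> \<and> real (card (\<phi> ` P \<inter> P)) \<ge> c * real (card P)}"

end

theory Submission
  imports Defs
begin

text \<open>
Let \<open>N\<close> be the number of points of \<open>P\<close> and let \<open>m = O(sqrt N)\<close> be the number of cutting lines. The
number of cutting lines that separate two points is a metric on \<open>P\<close>, and on average its balls are
as in a planar grid. Call a triple of points close if its last two points are within a bounded
distance of the first. An affine map is determined by its values on a non-collinear triple. Hence,
if there is a set \<open>T\<close> of \<open>O(N)\<close> close triples such that every rich map \<open>\<phi>\<close> sends at least a
constant times \<open>N\<close> non-collinear triples of \<open>T\<close> to triples of \<open>T\<close>, then the pairs \<open>(t, \<phi> t)\<close>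
in \<open>T \<times> T\<close> are distinct for distinct maps, and the number of rich maps is
\<open>O(N\<^sup>2) / N = O(N)\<close> (lemma \<open>count_maps_by_triples\<close>). Two facts about arrangements of \<open>m\<close> lines
supply such a set.

Few crowded points. For every radius \<open>k\<close> and every \<open>\<delta> > 0\<close> there is a constant \<open>K\<close> such that all but
\<open>\<delta> m\<^sup>2\<close> points have at most \<open>K\<close> points within distance \<open>k\<close>; \<open>T\<close> consists of the close triples
at the points that are not crowded. The average degree of a cell is bounded for trivial reasons, but
a cell of small degree may be next to one of huge degree, so the mean does not control balls of
radius \<open>2\<close>. The zone theorem bounds the sum of the squared degrees by \<open>O(m\<^sup>2)\<close>. By
Cauchy-Schwarz a small set of cells then has a small neighbourhood, so the set of cells with a large
ball stays small when the radius grows by one (lemma \<open>few_crowded_vertices\<close>).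

Many close non-collinear triples. For a rich map \<open>\<phi>\<close>, the cutting lines together with their preimages
under \<open>\<phi>\<close> are \<open>2 m\<close> lines that separate the points \<open>x\<close> of \<open>P\<close> with \<open>\<phi> x\<close> in \<open>P\<close>. Closeness with
respect to these \<open>2 m\<close> lines is closeness both of the points and of their images. A point has
at least \<open>r\<^sup>2\<close> vertices of the arrangement within distance \<open>2 r\<close>, and points at distance at least
\<open>4 r\<close> have disjoint such sets, so a set of points with pairwise distances at least \<open>4 r\<close> has
size at most \<open>(2 m / r)\<^sup>2\<close> (lemma \<open>packing\<close>). Balls of radius \<open>4 r\<close> around a maximal set of this
kind cover the points. A ball whose points lie on one line has only \<open>O(r)\<close> points, because
every cutting line meets this line at most once. The collinear balls thus cover only
\<open>O(m\<^sup>2 / r)\<close> points, a small part of \<open>c N\<close> when \<open>r\<close> is large; the quadratic gain in the packing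
bound is what beats the factor \<open>r\<close>. The centres of the other balls give the required triples.

Both facts involve the lines only through their sides at finitely many points, so the lines may be moved
slightly into general position (lemma \<open>perturb_to_general_position\<close>).

Only sets with few points remain. If the points that a rich map keeps in \<open>P\<close> lie on a line, the map
can be composed with maps that fix this line pointwise, and there are infinitely many rich maps.
Otherwise a rich map is determined by the images of three points of \<open>P\<close>, and the number of rich maps
is at most \<open>N^6\<close>.
\<close>

section \<open>Lines as affine forms\<close>

text \<open>The form \<open>w\<close> is the affine function \<open>x \<mapsto> w\<^sub>1 x\<^sub>1 + w\<^sub>2 x\<^sub>2 + w\<^sub>3\<close>, and the line is its zero set. Working
with the form rather than with the line fixes a positive side, so that a cell is a set of forms.\<close>

type_synonym form = "real^3"

definition nrm :: "form \<Rightarrow> real^2" where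
  "nrm w = vector [w$1, w$2]"

text \<open>The homogeneous coordinates of a point are \<open>hom x 1\<close>, and evaluating a form is an inner product with
them. Conditions of general position on a form therefore say that it avoids certain hyperplanes
of \<open>\<real>\<^sup>3\<close>.\<close>

definition hom :: "real^2 \<Rightarrow> real \<Rightarrow> form" where
  "hom u c = vector [u$1, u$2, c]"

definition ev :: "form \<Rightarrow> real^2 \<Rightarrow> real" where
  "ev w x = nrm w \<bullet> x + w$3"

definition det2 :: "real^2 \<Rightarrow> real^2 \<Rightarrow> real" where
  "det2 a b = a$1 * b$2 - a$2 * b$1"

definition dir :: "form \<Rightarrow> real^2" where
  "dir w = vector [- (nrm w $ 2), nrm w $ 1]"

lemma inner2: "(x::real^2) \<bullet> y = x$1 * y$1 + x$2 * y$2"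
  by (simp add: inner_vec_def sum_2)

lemma inner_hom: "v \<bullet> hom u c = nrm v \<bullet> u + v$3 * c"
  by (simp add: inner_vec_def sum_2 sum_3 hom_def nrm_def)

lemma ev_eq_inner: "ev v x = v \<bullet> hom x 1"
  by (simp add: ev_def inner_hom)

lemma hom_nonzero: "u \<noteq> 0 \<or> c \<noteq> 0 \<Longrightarrow> hom u c \<noteq> 0"
  by (auto simp: vec_eq_iff forall_2 forall_3 hom_def)

lemma inner_dir: "a \<bullet> dir w = det2 (nrm w) a"
  by (simp add: inner2 dir_def det2_def)

lemma det2_swap: "det2 a b = - det2 b a"
  by (simp add: det2_def)

lemma det2_self [simp]: "det2 a a = 0"
  by (simp add: det2_def)

lemma ev_move: "ev w (x + t *\<^sub>R e) = ev w x + t * (nrm w \<bullet> e)"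
  by (simp add: ev_def inner_add_right)

lemma ev_segment: "ev w (x + t *\<^sub>R (y - x)) = (1 - t) * ev w x + t * ev w y"
  by (simp add: ev_def inner_add_right inner_diff_right algebra_simps)

lemma vec2_nonzero: "(a::real^2) \<noteq> 0 \<longleftrightarrow> a$1 \<noteq> 0 \<or> a$2 \<noteq> 0"
  by (simp add: vec_eq_iff forall_2)

lemma dir_nonzero: "nrm w \<noteq> 0 \<Longrightarrow> dir w \<noteq> 0"
  unfolding vec2_nonzero by (auto simp: dir_def)

lemma orthogonal_parallel:
  assumes "a \<noteq> 0" "a \<bullet> e = 0" "e \<noteq> 0" "a \<bullet> z = (0::real)"
  shows "\<exists>t. (z::real^2) = t *\<^sub>R e"
proof -
  have d: "e$1 * z$2 = e$2 * z$1"
  proof -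
    have 1: "a$1 * (e$1 * z$2 - e$2 * z$1) = 0" "a$2 * (e$1 * z$2 - e$2 * z$1) = 0"
      using assms(2,4) unfolding inner2 by algebra+
    then show ?thesis using assms(1) unfolding vec2_nonzero by auto
  qed
  show ?thesis
  proof (cases "e$1 = 0")
    case True
    then have "e$2 \<noteq> 0" using assms(3) vec2_nonzero by auto
    then have "z = (z$2 / e$2) *\<^sub>R e"
      using d True by (simp add: vec_eq_iff forall_2)
    then show ?thesis by blast
  next
    case False
    then have "z = (z$1 / e$1) *\<^sub>R e"
      using d by (simp add: vec_eq_iff forall_2 field_simps)
    then show ?thesis by blast
  qed
qed

lemma ex_zero: assumes "nrm w \<noteq> 0" shows "\<exists>p. ev w p = 0"
proof
  show "ev w ((- w$3 / (nrm w \<bullet> nrm w)) *\<^sub>R nrm w) = 0"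
    using assms by (simp add: ev_def)
qed

lemma crossing_unique:
  assumes "det2 (nrm v) (nrm w) \<noteq> 0" "ev v z = 0" "ev w z = 0" "ev v z' = 0" "ev w z' = 0"
  shows "z = z'"
proof -
  have "nrm v \<bullet> (z - z') = 0" "nrm w \<bullet> (z - z') = 0"
    using assms(2-5) by (simp_all add: ev_def inner_diff_right)
  then have "det2 (nrm v) (nrm w) * (z - z')$1 = 0" "det2 (nrm v) (nrm w) * (z - z')$2 = 0"
    unfolding inner2 det2_def by algebra+
  then show ?thesis using assms(1) by (simp add: vec_eq_iff forall_2)
qed

lemma crossing_exists:
  assumes "det2 (nrm v) (nrm w) \<noteq> 0"
  shows "\<exists>z. ev v z = 0 \<and> ev w z = 0"
proof -
  have "nrm v \<noteq> 0" using assms by (auto simp: det2_def)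
  then obtain p where p: "ev v p = 0" using ex_zero by blast
  have d: "nrm w \<bullet> dir v \<noteq> 0" "nrm v \<bullet> dir v = 0" using assms by (auto simp: inner_dir)
  define t where "t = - ev w p / (nrm w \<bullet> dir v)"
  have "ev v (p + t *\<^sub>R dir v) = 0" "ev w (p + t *\<^sub>R dir v) = 0"
    using p d unfolding ev_move t_def by simp_all
  then show ?thesis by blast
qed

section \<open>Perturbation to general position\<close>

definition transversal :: "form set \<Rightarrow> bool" where
  "transversal W \<longleftrightarrow> finite W \<and> (\<forall>w\<in>W. nrm w \<noteq> 0) \<and>
     (\<forall>v\<in>W. \<forall>w\<in>W. v \<noteq> w \<longrightarrow> det2 (nrm v) (nrm w) \<noteq> 0)"

definition no_three_concurrent :: "form set \<Rightarrow> bool" where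
  "no_three_concurrent W \<longleftrightarrow>
     (\<forall>u\<in>W. \<forall>v\<in>W. \<forall>w\<in>W. \<forall>z. u \<noteq> v \<and> u \<noteq> w \<and> v \<noteq> w \<longrightarrow>
        \<not> (ev u z = 0 \<and> ev v z = 0 \<and> ev w z = 0))"

text \<open>The inequality says that the segment from \<open>x\<close> to \<open>y\<close> does not meet the lines of \<open>v\<close> and \<open>w\<close> at the
same parameter.\<close>

definition crossed_separately :: "form set \<Rightarrow> (real^2) set \<Rightarrow> bool" where
  "crossed_separately W P \<longleftrightarrow>
     (\<forall>v\<in>W. \<forall>w\<in>W. \<forall>x\<in>P. \<forall>y\<in>P. v \<noteq> w \<and> x \<noteq> y \<longrightarrow> ev v x * ev w y \<noteq> ev w x * ev v y)"

text \<open>The forms with prescribed strict signs at finitely many points form a nonempty open set, which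
finitely many hyperplanes, being null sets, cannot cover.\<close>

lemma avoid_hyperplanes:
  fixes w :: form
  assumes "finite N" "0 \<notin> N" "finite P" "\<And>x. x \<in> P \<Longrightarrow> ev w x \<noteq> 0"
  shows "\<exists>v. (\<forall>n\<in>N. v \<bullet> n \<noteq> 0) \<and> (\<forall>x\<in>P. ev v x * ev w x > 0)"
proof -
  let ?O = "\<Inter>x\<in>P. {v. ev v x * ev w x > 0}"
  have "open ?O"
    using \<open>finite P\<close> by (intro open_INT ballI open_Collect_less) (auto simp: ev_eq_inner intro!: continuous_intros)
  moreover have "w \<in> ?O" using assms(4) by (auto simp: zero_less_mult_iff not_less order_less_le)
  ultimately have "\<not> negligible ?O" using open_not_negligible by blast
  moreover have "negligible (\<Union>n\<in>N. {v. n \<bullet> v = 0})"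
    using assms(1,2) by (intro negligible_Union) (auto intro!: negligible_hyperplane)
  ultimately have "\<not> ?O \<subseteq> (\<Union>n\<in>N. {v. n \<bullet> v = 0})" using negligible_subset by blast
  then obtain v where "v \<in> ?O" "v \<notin> (\<Union>n\<in>N. {v. n \<bullet> v = 0})" by blast
  then show ?thesis by (intro exI[of _ v]) (simp add: inner_commute)
qed

text \<open>The forms are perturbed one after the other. Given the forms chosen so far, the new form has to avoid
one hyperplane of \<open>\<real>\<^sup>3\<close> in order to define a line, one for every earlier line (it must not be parallel), one for every earlier
crossing point (it must not pass through it), and one for every earlier line and pair of points of
\<open>P\<close> (it must not meet the segment of the two points where the earlier line does).\<close>

lemma perturb_to_general_position:
  fixes f :: "'i \<Rightarrow> form"
  assumes "finite I" "finite P" "\<And>i x. i \<in> I \<Longrightarrow> x \<in> P \<Longrightarrow> ev (f i) x \<noteq> 0"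
  shows "\<exists>g. inj_on g I \<and> (\<forall>i\<in>I. \<forall>x\<in>P. ev (g i) x * ev (f i) x > 0) \<and>
     transversal (g ` I) \<and> no_three_concurrent (g ` I) \<and> crossed_separately (g ` I) P"
  using assms(1,3)
proof (induction I rule: finite_induct)
  case empty
  then show ?case by (auto simp: transversal_def no_three_concurrent_def crossed_separately_def)
next
  case (insert i I)
  then obtain g where g: "inj_on g I" "\<forall>i\<in>I. \<forall>x\<in>P. ev (g i) x * ev (f i) x > 0"
     "transversal (g ` I)" "no_three_concurrent (g ` I)" "crossed_separately (g ` I) P"
    by auto
  let ?W = "g ` I"
  have nz: "ev w x \<noteq> 0" if wx: "w \<in> ?W" "x \<in> P" for w x
  proof -
    obtain i where "i \<in> I" "w = g i" using wx(1) by blast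
    then show ?thesis using g(2) wx(2) by (metis less_irrefl mult_zero_left)
  qed
  have "\<exists>z. ev v z = 0 \<and> ev w z = 0" if "v \<in> ?W" "w \<in> ?W" "v \<noteq> w" for v w
    using crossing_exists[of v w] g(3) that unfolding transversal_def by blast
  then have "\<forall>v w. \<exists>z. v \<in> ?W \<and> w \<in> ?W \<and> v \<noteq> w \<longrightarrow> ev v z = 0 \<and> ev w z = 0"
    by blast
  then obtain cr where cr: "\<And>v w. v \<in> ?W \<Longrightarrow> w \<in> ?W \<Longrightarrow> v \<noteq> w \<Longrightarrow> ev v (cr v w) = 0 \<and> ev w (cr v w) = 0"
    by metis
  \<comment> \<open>\<open>N1\<close> keeps the normal nonzero and not parallel to the earlier ones,
    \<open>N2\<close> keeps it off their crossing points, and \<open>N3\<close> separates the parameters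
    at which segments of \<open>P\<close> are crossed.\<close>
  define N1 where "N1 = {hom (axis 1 1) 0} \<union> (\<lambda>w. hom (dir w) 0) ` ?W"
  define N2 where "N2 = (\<lambda>(v,w). hom (cr v w) 1) ` (?W \<times> ?W)"
  define N3 where "N3 = {ev w x *\<^sub>R hom y 1 - ev w y *\<^sub>R hom x 1 | w x y. w \<in> ?W \<and> x \<in> P \<and> y \<in> P \<and> x \<noteq> y}"
  have "N3 \<subseteq> (\<lambda>(w,x,y). ev w x *\<^sub>R hom y 1 - ev w y *\<^sub>R hom x 1) ` (?W \<times> P \<times> P)"
    unfolding N3_def by force
  then have "finite N3" using insert.hyps assms(2) finite_subset by blast
  then have fin: "finite (N1 \<union> N2 \<union> N3)" unfolding N1_def N2_def using insert.hyps by simp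
  have a1: "(axis 1 1 :: real^2) \<noteq> 0" by (simp add: axis_eq_0_iff)
  have z1: "0 \<notin> N1" unfolding N1_def using g(3) dir_nonzero a1
    by (force simp: transversal_def hom_nonzero)
  have z2: "0 \<notin> N2" using hom_nonzero by (force simp: N2_def)
  have z3: "0 \<notin> N3"
  proof
    assume "0 \<in> N3"
    then obtain w x y where *: "w \<in> ?W" "x \<in> P" "x \<noteq> y" "ev w x *\<^sub>R hom y 1 - ev w y *\<^sub>R hom x 1 = 0"
      unfolding N3_def by (smt (verit) mem_Collect_eq)
    then have "ev w x = ev w y" "ev w x *\<^sub>R y = ev w y *\<^sub>R x"
      by (auto simp: vec_eq_iff forall_2 forall_3 hom_def)
    then have "ev w x = 0" using \<open>x \<noteq> y\<close> by auto
    then show False using nz * by blast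
  qed
  have "\<exists>v. (\<forall>n\<in>N1 \<union> N2 \<union> N3. v \<bullet> n \<noteq> 0) \<and> (\<forall>x\<in>P. ev v x * ev (f i) x > 0)"
    by (rule avoid_hyperplanes[OF fin _ assms(2)]) (use z1 z2 z3 insert.prems in auto)
  then obtain v where v: "\<And>n. n \<in> N1 \<union> N2 \<union> N3 \<Longrightarrow> v \<bullet> n \<noteq> 0"
    "\<And>x. x \<in> P \<Longrightarrow> ev v x * ev (f i) x > 0" by blast
  have v1: "nrm v \<noteq> 0" using v(1)[of "hom (axis 1 1) 0"] by (auto simp: N1_def inner_hom)
  have v2: "det2 (nrm w) (nrm v) \<noteq> 0" if "w \<in> ?W" for w
    using v(1)[of "hom (dir w) 0"] that by (auto simp: N1_def inner_hom inner_dir)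
  have v2': "v \<noteq> w" if "w \<in> ?W" for w using v2[OF that] by auto
  have v3: "\<not> (ev v z = 0 \<and> ev w z = 0 \<and> ev u z = 0)" if "w \<in> ?W" "u \<in> ?W" "w \<noteq> u" for w u z
  proof
    assume A: "ev v z = 0 \<and> ev w z = 0 \<and> ev u z = 0"
    then have "z = cr w u"
      using crossing_unique[of w u z "cr w u"] cr[OF that] g(3) that by (auto simp: transversal_def)
    moreover have "hom (cr w u) 1 \<in> N2" unfolding N2_def using that by force
    ultimately show False using v(1)[of "hom (cr w u) 1"] A by (auto simp: ev_eq_inner)
  qed
  have v4: "ev w x * ev v y \<noteq> ev v x * ev w y" if "w \<in> ?W" "x \<in> P" "y \<in> P" "x \<noteq> y" for w x y
  proof -
    have "ev w x *\<^sub>R hom y 1 - ev w y *\<^sub>R hom x 1 \<in> N3"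
      unfolding N3_def using that by blast
    then have "v \<bullet> (ev w x *\<^sub>R hom y 1 - ev w y *\<^sub>R hom x 1) \<noteq> 0" using v(1) by blast
    then show ?thesis by (simp add: inner_diff_right inner_hom ev_def[of v] algebra_simps)
  qed
  let ?g = "g(i := v)"
  have im: "?g ` insert i I = insert v ?W" using insert.hyps by auto
  show ?case
  proof (intro exI[of _ ?g] conjI)
    show "inj_on ?g (insert i I)"
      using g(1) insert.hyps v2' by (auto simp: inj_on_def)
    show "\<forall>j\<in>insert i I. \<forall>x\<in>P. ev (?g j) x * ev (f j) x > 0"
      using g(2) v(2) by auto
    show "transversal (?g ` insert i I)"
      unfolding im transversal_def using g(3) v1 v2 det2_swap[of "nrm v"] insert.hyps
      by (auto simp: transversal_def)
    show "no_three_concurrent (?g ` insert i I)"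
      unfolding im no_three_concurrent_def using g(4) v3 unfolding no_three_concurrent_def
      by (metis insert_iff)
    show "crossed_separately (?g ` insert i I) P"
      unfolding im crossed_separately_def
    proof (intro ballI impI, elim conjE)
      fix u w x y assume A: "u \<in> insert v ?W" "w \<in> insert v ?W" "x \<in> P" "y \<in> P" "u \<noteq> w" "x \<noteq> y"
      consider "u \<in> ?W" "w \<in> ?W" | "u = v" "w \<in> ?W" | "w = v" "u \<in> ?W" using A by auto
      then show "ev u x * ev w y \<noteq> ev w x * ev u y"
      proof cases
        case 1 then show ?thesis using g(5) A unfolding crossed_separately_def by blast
      next
        case 2 then show ?thesis using v4[of w x y] A by auto
      next
        case 3 then show ?thesis using v4[of u x y] A by auto
      qed
    qed
  qed
qed

section \<open>The zone theorem\<close>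

text \<open>The position of \<open>q\<close> with respect to the lines of \<open>U\<close> is the sign pattern \<open>\<sigma>\<close>. Only \<open>\<sigma> \<inter> U\<close> matters,
so a pattern can be tested on a subset of the lines without restricting it.\<close>

definition realizes :: "form set \<Rightarrow> real^2 \<Rightarrow> form set \<Rightarrow> bool" where
  "realizes U q \<sigma> \<longleftrightarrow> (\<forall>w\<in>U. ev w q \<noteq> 0 \<and> (ev w q > 0 \<longleftrightarrow> w \<in> \<sigma>))"

definition line_cells :: "form set \<Rightarrow> form \<Rightarrow> form set set" where
  "line_cells U l = {\<sigma>. \<sigma> \<subseteq> U \<and> (\<exists>p. ev l p = 0 \<and> realizes U p \<sigma>)}"

text \<open>A pair stands for a side, on the line of \<open>h\<close>, of the cell that has pattern \<open>\<sigma>\<close> and touches \<open>l\<close> from the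
side given by the sign of \<open>s\<close>. Only one of the two orientations is counted: when \<open>l\<close> is traversed
in the direction \<open>e\<close>, the cell comes after the crossing with \<open>h\<close>. The other orientation is
obtained from \<open>-e\<close>.\<close>

definition zone_edges :: "form set \<Rightarrow> form \<Rightarrow> real \<Rightarrow> real^2 \<Rightarrow> (form set \<times> form) set" where
  "zone_edges U l s e = {(\<sigma>, h). \<sigma> \<in> line_cells U l \<and> h \<in> U \<and> (h \<in> \<sigma> \<longleftrightarrow> nrm h \<bullet> e > 0) \<and>
     (\<exists>q. s * ev l q > 0 \<and> ev h q = 0 \<and> realizes (U - {h}) q \<sigma>)}"

lemma affine_same_sign_at_0:
  fixes p q b t :: real
  assumes "p * q < 0" "(b + t * p) * (b + t * q) > 0"
  shows "(b + t * p) * b > 0"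
proof -
  have eq: "(b + t * p) * b * (p - q) = p * ((b + t * p) * (b + t * q)) - q * (b + t * p)\<^sup>2"
    by (simp add: algebra_simps power2_eq_square)
  have nz: "(b + t * p)\<^sup>2 > 0" using assms(2) by (cases "b + t * p = 0") auto
  show ?thesis
  proof (cases "p > 0")
    case True
    then have "q < 0" using assms(1) by (simp add: mult_less_0_iff)
    then have "p * ((b + t * p) * (b + t * q)) - q * (b + t * p)\<^sup>2 > 0"
      using True assms(2) nz by (smt (verit) mult_pos_pos mult_neg_pos)
    then have "(b + t * p) * b * (p - q) > 0" by (simp only: eq)
    moreover have "p - q > 0" using True \<open>q < 0\<close> by simp
    ultimately show ?thesis using zero_less_mult_pos2 by blast
  next
    case False
    then have "p < 0" "q > 0" using assms(1) by (auto simp: mult_less_0_iff)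
    then have "p * ((b + t * p) * (b + t * q)) - q * (b + t * p)\<^sup>2 < 0"
      using assms(2) nz by (smt (verit) mult_pos_pos mult_neg_pos)
    then have "(b + t * p) * b * (p - q) < 0" by (simp only: eq)
    then have "(b + t * p) * b * (q - p) > 0" by (simp only: minus_diff_eq[of p q, symmetric] mult_minus_right neg_0_less_iff_less)
    moreover have "q - p > 0" using \<open>p < 0\<close> \<open>q > 0\<close> by simp
    ultimately show ?thesis using zero_less_mult_pos2 by blast
  qed
qed

text \<open>Two cells lie on different sides of \<open>g\<close>, and the lines of \<open>h\<close> and \<open>k\<close> both bound both cells, leave
them on the same side, and are oriented alike with respect to \<open>g\<close>. If the forms are divided by their slopes along \<open>g\<close>, their difference is
constant along \<open>g\<close>, hence an affine function of \<open>ev g\<close>. On each side of \<open>g\<close> it changes sign between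
the points of tangency of the two lines, so it would have a positive and a negative root.\<close>

lemma common_tangent_unique:
  assumes "nrm g \<noteq> 0" and c: "nrm h \<bullet> dir g \<noteq> 0" "nrm k \<bullet> dir g \<noteq> 0"
    and z: "ev h u = 0" "ev h v = 0" "ev k u' = 0" "ev k v' = 0"
    and g: "ev g u * ev g v < 0" "ev g u * ev g u' > 0" "ev g v * ev g v' > 0"
    and same: "ev k u * ev k v > 0" "ev h u' * ev h v' > 0"
    and orient: "(ev k u / (nrm k \<bullet> dir g)) * (ev h u' / (nrm h \<bullet> dir g)) > 0"
  shows False
proof -
  define F where "F = (\<lambda>x. ev k x / (nrm k \<bullet> dir g) - ev h x / (nrm h \<bullet> dir g))"
  define a where "a = (1 / (nrm k \<bullet> dir g)) *\<^sub>R nrm k - (1 / (nrm h \<bullet> dir g)) *\<^sub>R nrm h"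
  have Fa: "F x = a \<bullet> x + F 0" for x
    unfolding F_def a_def ev_def by (simp add: inner_diff_left inner_add_left add_divide_distrib)
  have "dir g \<bullet> a = 0" unfolding a_def using c by (simp add: inner_diff_right inner_commute)
  moreover have "dir g \<bullet> nrm g = 0" by (metis det2_self inner_commute inner_dir)
  ultimately obtain t where t: "a = t *\<^sub>R nrm g"
    using orthogonal_parallel[of "dir g" "nrm g" a] assms(1) dir_nonzero by blast
  define b where "b = F 0 - t * g$3"
  have Fb: "F x = b + t * ev g x" for x
    using Fa[of x] unfolding t b_def by (simp add: ev_def algebra_simps)
  have F1: "F u = ev k u / (nrm k \<bullet> dir g)" "F v = ev k v / (nrm k \<bullet> dir g)"
    "F u' = - (ev h u' / (nrm h \<bullet> dir g))" "F v' = - (ev h v' / (nrm h \<bullet> dir g))"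
    unfolding F_def using z by simp_all
  have "F u * F v = ev k u * ev k v / (nrm k \<bullet> dir g)\<^sup>2"
    "F u' * F v' = ev h u' * ev h v' / (nrm h \<bullet> dir g)\<^sup>2"
    unfolding F1 by (simp_all add: power2_eq_square)
  then have pos: "F u * F v > 0" "F u' * F v' > 0" using same c by simp_all
  have neg: "F u * F u' < 0" unfolding F1 using orient by simp
  have "ev g u' * ev g v' < 0" using g by (auto simp: mult_less_0_iff zero_less_mult_iff)
  then have "F u * b > 0" "F u' * b > 0"
    using affine_same_sign_at_0[OF g(1), of b t] affine_same_sign_at_0[of "ev g u'" "ev g v'" b t] pos
    unfolding Fb by auto
  then show False using neg by (auto simp: mult_less_0_iff zero_less_mult_iff)
qed

text \<open>Take the line whose crossing with \<open>l\<close> is the last one in the direction \<open>e\<close>. A point of \<open>l\<close> beyond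
this crossing is beyond all crossings, which determines its cell.\<close>

lemma last_crossing:
  assumes "finite U" "U \<noteq> {}" "nrm l \<noteq> 0" "e \<noteq> 0" "nrm l \<bullet> e = 0" "\<And>h. h \<in> U \<Longrightarrow> nrm h \<bullet> e \<noteq> 0"
  shows "\<exists>h\<in>U. \<forall>\<sigma>\<in>line_cells U l. \<sigma> = {w\<in>U. nrm w \<bullet> e > 0} \<or> (h \<in> \<sigma> \<longleftrightarrow> nrm h \<bullet> e < 0)"
proof -
  obtain p0 where p0: "ev l p0 = 0" using ex_zero assms(3) by blast
  define t where "t = (\<lambda>h. - ev h p0 / (nrm h \<bullet> e))"
  have sgn: "ev h (p0 + s *\<^sub>R e) * (nrm h \<bullet> e) > 0 \<longleftrightarrow> s > t h" if "h \<in> U" for h s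
  proof -
    let ?b = "nrm h \<bullet> e"
    have b: "?b \<noteq> 0" using assms(6) that by blast
    have "ev h (p0 + s *\<^sub>R e) * ?b = ?b\<^sup>2 * (s - t h)"
      unfolding ev_move t_def using b by (simp add: field_simps power2_eq_square)
    then show ?thesis using b by (simp add: zero_less_mult_iff)
  qed
  obtain h where h: "h \<in> U" "\<And>w. w \<in> U \<Longrightarrow> t w \<le> t h"
    using ex_is_arg_min_if_finite[OF assms(1,2), of "\<lambda>h. - t h"] unfolding is_arg_min_linorder by auto
  have right: "\<forall>w\<in>U. ev w p * (nrm w \<bullet> e) > 0" if "ev l p = 0" "ev h p * (nrm h \<bullet> e) > 0" for p
  proof -
    have "nrm l \<bullet> (p - p0) = 0" using that p0 by (simp add: ev_def inner_diff_right)
    then obtain s where "p - p0 = s *\<^sub>R e" using orthogonal_parallel assms(3-5) by blast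
    then have p: "p = p0 + s *\<^sub>R e" by (simp add: algebra_simps)
    then show ?thesis using sgn h that(2) by (metis order_le_less_trans)
  qed
  have "h \<in> \<sigma> \<longleftrightarrow> nrm h \<bullet> e < 0" if \<sigma>: "\<sigma> \<in> line_cells U l" "\<sigma> \<noteq> {w\<in>U. nrm w \<bullet> e > 0}" for \<sigma>
  proof -
    obtain p where p: "ev l p = 0" "realizes U p \<sigma>" "\<sigma> \<subseteq> U" using \<sigma>(1) by (auto simp: line_cells_def)
    have "\<sigma> = {w\<in>U. nrm w \<bullet> e > 0}" if "ev h p * (nrm h \<bullet> e) > 0"
    proof -
      have "w \<in> \<sigma> \<longleftrightarrow> nrm w \<bullet> e > 0" if "w \<in> U" for w
        using right[OF p(1) \<open>ev h p * (nrm h \<bullet> e) > 0\<close>] p(2) that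
        unfolding realizes_def by (metis zero_less_mult_iff order_less_asym)
      then show ?thesis using p(3) by blast
    qed
    then have "\<not> ev h p * (nrm h \<bullet> e) > 0" using \<sigma>(2) by blast
    moreover have "ev h p \<noteq> 0" "h \<in> \<sigma> \<longleftrightarrow> ev h p > 0" using p(2) h by (auto simp: realizes_def)
    moreover have "nrm h \<bullet> e \<noteq> 0" using assms(6) h by blast
    ultimately show ?thesis by (auto simp: zero_less_mult_iff)
  qed
  then show ?thesis using h(1) by blast
qed

lemma finite_line_cells: "finite U \<Longrightarrow> finite (line_cells U l)"
  by (rule finite_subset[of _ "Pow U"]) (auto simp: line_cells_def)

lemma line_cells_restrict:
  assumes "\<sigma> \<in> line_cells U l"
  shows "\<sigma> - {h} \<in> line_cells (U - {h}) l"
  using assms unfolding line_cells_def realizes_def by blast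

lemma card_line_cells:
  assumes "finite U" "nrm l \<noteq> 0" "e \<noteq> 0" "nrm l \<bullet> e = 0" "\<And>h. h \<in> U \<Longrightarrow> nrm h \<bullet> e \<noteq> 0"
  shows "card (line_cells U l) \<le> card U + 1"
  using assms(1,5)
proof (induction "card U" arbitrary: U)
  case 0
  then have "U = {}" by simp
  then have "line_cells U l \<subseteq> {{}}" by (auto simp: line_cells_def)
  then show ?case using card_mono[of "{{}}" "line_cells U l"] by simp
next
  case (Suc n)
  then have "U \<noteq> {}" by auto
  define R where "R = {w\<in>U. nrm w \<bullet> e > 0}"
  obtain h where h: "h \<in> U" and left: "\<And>\<sigma>. \<sigma> \<in> line_cells U l \<Longrightarrow> \<sigma> \<noteq> R \<Longrightarrow> h \<in> \<sigma> \<longleftrightarrow> nrm h \<bullet> e < 0"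
    using last_crossing[OF Suc.prems(1) \<open>U \<noteq> {}\<close> assms(2-4) Suc.prems(2)] unfolding R_def by blast
  have fin: "finite (line_cells V l)" if "V \<subseteq> U" for V
    by (rule finite_line_cells) (use that Suc.prems(1) finite_subset in auto)
  have "card (line_cells U l - {R}) \<le> card (line_cells (U - {h}) l)"
  proof (rule card_inj_on_le[of "\<lambda>\<sigma>. \<sigma> - {h}"])
    show "inj_on (\<lambda>\<sigma>. \<sigma> - {h}) (line_cells U l - {R})"
    proof (rule inj_onI)
      fix \<sigma> \<tau> assume A: "\<sigma> \<in> line_cells U l - {R}" "\<tau> \<in> line_cells U l - {R}" "\<sigma> - {h} = \<tau> - {h}"
      have "h \<in> \<sigma> \<longleftrightarrow> h \<in> \<tau>" using left[of \<sigma>] left[of \<tau>] A by simp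
      then show "\<sigma> = \<tau>" using A(3) by blast
    qed
    show "(\<lambda>\<sigma>. \<sigma> - {h}) ` (line_cells U l - {R}) \<subseteq> line_cells (U - {h}) l"
      using line_cells_restrict by blast
  qed (use fin in auto)
  also have "\<dots> \<le> card (U - {h}) + 1"
    using Suc.hyps(1)[of "U - {h}"] Suc.hyps(2) Suc.prems h by auto
  also have "\<dots> = card U" using h Suc.prems(1) Suc.hyps(2) by simp
  finally show ?case using card_Diff_singleton_if[of "line_cells U l" R] by (auto split: if_splits)
qed


text \<open>Induction, removing the line \<open>g\<close> whose crossing with \<open>l\<close> is the last. A cell other than the last one
lies before the crossing with \<open>g\<close>, so \<open>g\<close> contributes only one side, namely to the last cell. Putting
\<open>g\<close> back splits at most one cell along \<open>l\<close>, into the patterns \<open>L\<close> and \<open>R\<close> below, and doubles a side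
only if its line bounds both parts. Such a line is a common tangent of two cells separated by
\<open>g\<close> and leaves both on the same side, so by the uniqueness of common tangents there are at
most two of them.\<close>

lemma card_zone_edges:
  assumes "transversal U" "nrm l \<noteq> 0" "e \<noteq> 0" "nrm l \<bullet> e = 0" "\<And>h. h \<in> U \<Longrightarrow> nrm h \<bullet> e \<noteq> 0"
  shows "card (zone_edges U l s e) \<le> 3 * card U"
  using assms(1,5)
proof (induction "card U" arbitrary: U)
  case 0
  then have "U = {}" by (simp add: transversal_def)
  then show ?case by (simp add: zone_edges_def)
next
  case (Suc n)
  let ?Z = "zone_edges U l s e"
  have finU: "finite U" using Suc.prems(1) by (simp add: transversal_def)
  have "U \<noteq> {}" using Suc.hyps(2) by auto
  define R where "R = {w\<in>U. nrm w \<bullet> e > 0}"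
  obtain g where g: "g \<in> U" and left: "\<And>\<sigma>. \<sigma> \<in> line_cells U l \<Longrightarrow> \<sigma> \<noteq> R \<Longrightarrow> g \<in> \<sigma> \<longleftrightarrow> nrm g \<bullet> e < 0"
    using last_crossing[OF finU \<open>U \<noteq> {}\<close> assms(2-4) Suc.prems(2)] unfolding R_def by blast
  have ge: "nrm g \<bullet> e \<noteq> 0" using Suc.prems(2) g by blast
  have gR: "g \<in> R \<longleftrightarrow> nrm g \<bullet> e > 0" using g by (simp add: R_def)
  \<comment> \<open>The patterns \<open>R\<close> and \<open>L\<close> are the parts of the last cell
    after and before \<open>g\<close>.\<close>
  define L where "L = (if g \<in> R then R - {g} else insert g R)"
  have gL: "g \<in> L \<longleftrightarrow> g \<notin> R" "L - {g} = R - {g}" by (auto simp: L_def)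
  \<comment> \<open>\<open>D\<close> collects the lines whose side is doubled by inserting
    \<open>g\<close>.\<close>
  define D where "D = {h \<in> U - {g}. (R, h) \<in> ?Z \<and> (L, h) \<in> ?Z}"
  define X where "X = ?Z - ({(R, g)} \<union> Pair R ` D)"
  have fin: "finite (zone_edges V l s e)" if "V \<subseteq> U" for V
  proof (rule finite_subset)
    show "zone_edges V l s e \<subseteq> line_cells V l \<times> V" by (auto simp: zone_edges_def)
    have "finite V" using that finU finite_subset by blast
    then show "finite (line_cells V l \<times> V)" using finite_line_cells by blast
  qed
  have finD: "finite D" using finU by (simp add: D_def)
  have ng: "h \<noteq> g" if "(\<sigma>, h) \<in> X" for \<sigma> h
    using that left ge unfolding X_def zone_edges_def by force
  have "card X \<le> card (zone_edges (U - {g}) l s e)"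
  proof (rule card_inj_on_le[of "\<lambda>(\<sigma>, h). (\<sigma> - {g}, h)"])
    show "inj_on (\<lambda>(\<sigma>, h). (\<sigma> - {g}, h)) X"
    proof (rule inj_onI)
      fix z z' assume zz: "z \<in> X" "z' \<in> X" "(\<lambda>(\<sigma>, h). (\<sigma> - {g}, h)) z = (\<lambda>(\<sigma>, h). (\<sigma> - {g}, h)) z'"
      obtain \<sigma> h \<tau> where z: "z = (\<sigma>, h)" "z' = (\<tau>, h)" using zz(3) by (cases z, cases z') auto
      have A: "(\<sigma>, h) \<in> X" "(\<tau>, h) \<in> X" "\<sigma> - {g} = \<tau> - {g}" using zz z by auto
      have Z: "(\<sigma>, h) \<in> ?Z" "(\<tau>, h) \<in> ?Z" "h \<in> U - {g}" using A(1,2) ng[OF A(1)] by (auto simp: X_def zone_edges_def)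
      then have C: "\<sigma> \<in> line_cells U l" "\<tau> \<in> line_cells U l" by (auto simp: zone_edges_def)
      have "h \<notin> D" if "\<sigma> = R \<or> \<tau> = R" using that A(1,2) by (auto simp: X_def)
      moreover have "h \<in> D" if "\<sigma> = R" "\<tau> \<noteq> R"
      proof -
        have "\<tau> = L" using that A(3) unfolding L_def by auto
        then show ?thesis using Z that by (simp add: D_def)
      qed
      moreover have "h \<in> D" if "\<tau> = R" "\<sigma> \<noteq> R"
      proof -
        have "\<sigma> = L" using that A(3) unfolding L_def by auto
        then show ?thesis using Z that by (simp add: D_def)
      qed
      moreover have "\<sigma> = \<tau>" if "\<sigma> \<noteq> R" "\<tau> \<noteq> R"
        using left[OF C(1) that(1)] left[OF C(2) that(2)] A(3) by auto
      ultimately show "z = z'" unfolding z by blast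
    qed
    show "(\<lambda>(\<sigma>, h). (\<sigma> - {g}, h)) ` X \<subseteq> zone_edges (U - {g}) l s e"
    proof (rule image_subsetI)
      fix z assume "z \<in> X"
      then obtain \<sigma> h where z: "z = (\<sigma>, h)" and A: "(\<sigma>, h) \<in> X" by (cases z) auto
      then have Z: "(\<sigma>, h) \<in> ?Z" "h \<noteq> g" using ng[OF A] unfolding X_def by blast+
      then obtain q where q: "s * ev l q > 0" "ev h q = 0" "realizes (U - {h}) q \<sigma>"
        unfolding zone_edges_def by blast
      have "realizes (U - {g} - {h}) q (\<sigma> - {g})" using q(3) by (auto simp: realizes_def)
      then show "(\<lambda>(\<sigma>, h). (\<sigma> - {g}, h)) z \<in> zone_edges (U - {g}) l s e"
        using Z q line_cells_restrict[of \<sigma> U l g] unfolding zone_edges_def z by force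
    qed
  qed (use fin in auto)
  also have "\<dots> \<le> 3 * card (U - {g})"
  proof (rule Suc.hyps(1))
    show "n = card (U - {g})" using Suc.hyps(2) g finU by simp
    show "transversal (U - {g})" using Suc.prems(1) by (auto simp: transversal_def)
  qed (use Suc.prems in auto)
  finally have X: "card X \<le> 3 * n" using Suc.hyps(2) g finU by simp
  \<comment> \<open>Lines of \<open>D\<close> are classified by the side on which the cells lie relative
    to the direction of \<open>g\<close>; each class has at most one element.\<close>
  have D1: "card {h\<in>D. h \<in> R \<longleftrightarrow> (nrm h \<bullet> dir g > 0) = b} \<le> 1" for b
  proof -
    have "False" if hk: "h \<in> D" "k \<in> D" "h \<noteq> k" "h \<in> R \<longleftrightarrow> (nrm h \<bullet> dir g > 0) = b"
      "k \<in> R \<longleftrightarrow> (nrm k \<bullet> dir g > 0) = b" for h k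
    proof -
      have "(R, h) \<in> ?Z" "(L, h) \<in> ?Z" "(R, k) \<in> ?Z" "(L, k) \<in> ?Z" and U: "h \<in> U - {g}" "k \<in> U - {g}"
        using hk(1,2) by (auto simp: D_def)
      then obtain u v u' v' where z: "ev h u = 0" "ev h v = 0" "ev k u' = 0" "ev k v' = 0"
        and r: "realizes (U - {h}) u R" "realizes (U - {h}) v L" "realizes (U - {k}) u' R" "realizes (U - {k}) v' L"
        unfolding zone_edges_def by blast
      have sg: "ev g u \<noteq> 0" "ev g v \<noteq> 0" "ev g u' \<noteq> 0" "ev g v' \<noteq> 0"
        "ev g u > 0 \<longleftrightarrow> g \<in> R" "ev g v > 0 \<longleftrightarrow> g \<notin> R" "ev g u' > 0 \<longleftrightarrow> g \<in> R" "ev g v' > 0 \<longleftrightarrow> g \<notin> R"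
        using r U g gL(1) unfolding realizes_def by auto
      have L: "k \<in> L \<longleftrightarrow> k \<in> R" "h \<in> L \<longleftrightarrow> h \<in> R" using gL(2) U by auto
      have sh: "ev k u \<noteq> 0" "ev k v \<noteq> 0" "ev h u' \<noteq> 0" "ev h v' \<noteq> 0"
        "ev k u > 0 \<longleftrightarrow> k \<in> R" "ev k v > 0 \<longleftrightarrow> k \<in> R" "ev h u' > 0 \<longleftrightarrow> h \<in> R" "ev h v' > 0 \<longleftrightarrow> h \<in> R"
        using r U hk(3) L unfolding realizes_def by auto
      have d: "nrm h \<bullet> dir g \<noteq> 0" "nrm k \<bullet> dir g \<noteq> 0" "nrm g \<noteq> 0"
        using Suc.prems(1) U g unfolding inner_dir transversal_def by auto
      show False
      proof (rule common_tangent_unique[OF d(3,1,2) z])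
        show "ev g u * ev g v < 0" using sg by (auto simp: mult_less_0_iff)
        show "ev g u * ev g u' > 0" "ev g v * ev g v' > 0" using sg by (auto simp: zero_less_mult_iff)
        show "ev k u * ev k v > 0" "ev h u' * ev h v' > 0" using sh by (auto simp: zero_less_mult_iff)
        have "ev k u / (nrm k \<bullet> dir g) > 0 \<longleftrightarrow> b" "ev k u / (nrm k \<bullet> dir g) \<noteq> 0"
          using sh d hk(5) by (auto simp: zero_less_divide_iff)
        moreover have "ev h u' / (nrm h \<bullet> dir g) > 0 \<longleftrightarrow> b" "ev h u' / (nrm h \<bullet> dir g) \<noteq> 0"
          using sh d hk(4) by (auto simp: zero_less_divide_iff)
        ultimately show "(ev k u / (nrm k \<bullet> dir g)) * (ev h u' / (nrm h \<bullet> dir g)) > 0"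
          by (metis linorder_neqE_linordered_idom mult_neg_neg mult_pos_pos)
      qed
    qed
    then have "\<forall>h\<in>{h\<in>D. h \<in> R \<longleftrightarrow> (nrm h \<bullet> dir g > 0) = b}. \<forall>k\<in>{h\<in>D. h \<in> R \<longleftrightarrow> (nrm h \<bullet> dir g > 0) = b}. h = k"
      by blast
    then show ?thesis using card_le_Suc0_iff_eq[of "{h\<in>D. h \<in> R \<longleftrightarrow> (nrm h \<bullet> dir g > 0) = b}"] finD by simp
  qed
  let ?D = "\<lambda>b. {h\<in>D. h \<in> R \<longleftrightarrow> (nrm h \<bullet> dir g > 0) = b}"
  have "D = ?D True \<union> ?D False" by auto
  then have "card D \<le> card (?D True) + card (?D False)" using card_Un_le[of "?D True" "?D False"] by argo
  then have D: "card D \<le> 2" using D1[of True] D1[of False] by linarith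
  have "?Z \<subseteq> X \<union> ({(R, g)} \<union> Pair R ` D)" by (auto simp: X_def)
  then have "card ?Z \<le> card (X \<union> ({(R, g)} \<union> Pair R ` D))"
    by (rule card_mono[rotated]) (use fin[of U] finD in \<open>auto simp: X_def\<close>)
  also have "\<dots> \<le> card X + (card {(R, g)} + card (Pair R ` D))"
    by (meson add_left_mono card_Un_le order_trans)
  also have "\<dots> \<le> 3 * n + (1 + 2)"
    using X D card_image_le[OF finD, of "Pair R"] by simp
  finally show ?case using Suc.hyps(2) by simp
qed


text \<open>The line of \<open>h\<close> contains a side of the cell with pattern \<open>\<sigma>\<close>. A pattern that belongs to no cell has no
facets, so sums over all patterns \<open>\<sigma> \<subseteq> W\<close> are sums over the cells.\<close>

definition facet :: "form set \<Rightarrow> form set \<Rightarrow> form \<Rightarrow> bool" where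
  "facet W \<sigma> h \<longleftrightarrow> \<sigma> \<subseteq> W \<and> h \<in> W \<and> (\<exists>q. ev h q = 0 \<and> realizes (W - {h}) q \<sigma>)"

lemma facet_line_cell: "facet W \<sigma> l \<Longrightarrow> \<sigma> - {l} \<in> line_cells (W - {l}) l"
  unfolding facet_def line_cells_def realizes_def by blast

text \<open>The zone theorem. There are two choices for the side of \<open>l\<close> and two orientations, with at most
\<open>3 card W\<close> sides each, and at most \<open>2 card W\<close> cells touch \<open>l\<close>, which is itself one of their sides.\<close>

lemma card_zone:
  assumes "transversal W" "l \<in> W"
  shows "card {(\<sigma>, h). facet W \<sigma> l \<and> facet W \<sigma> h} \<le> 14 * card W"
proof -
  let ?U = "W - {l}" and ?e = "dir l"
  let ?Z = "\<lambda>s e. zone_edges ?U l s e"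
  let ?C = "line_cells ?U l"
  have fin: "finite W" using assms(1) by (simp add: transversal_def)
  have T: "transversal ?U" using assms(1) by (auto simp: transversal_def)
  have l: "nrm l \<noteq> 0" using assms by (simp add: transversal_def)
  have e: "?e \<noteq> 0" "nrm l \<bullet> ?e = 0" using dir_nonzero l by (auto simp: inner_dir)
  have he: "nrm h \<bullet> ?e \<noteq> 0" if "h \<in> ?U" for h
  proof -
    have "h \<in> W" "l \<noteq> h" using that by auto
    then show ?thesis using assms unfolding inner_dir transversal_def by blast
  qed
  have Z: "card (?Z s ?e) \<le> 3 * card W" "card (?Z s (- ?e)) \<le> 3 * card W" for s
  proof -
    have "card (?Z s ?e) \<le> 3 * card ?U" by (rule card_zone_edges[OF T l e]) (use he in auto)
    moreover have "card (?Z s (- ?e)) \<le> 3 * card ?U" by (rule card_zone_edges[OF T l]) (use e he in auto)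
    ultimately show "card (?Z s ?e) \<le> 3 * card W" "card (?Z s (- ?e)) \<le> 3 * card W"
      using card_Diff1_le[of W l] by linarith+
  qed
  have C: "card ?C \<le> card W"
  proof -
    have "card ?C \<le> card ?U + 1" by (rule card_line_cells[OF _ l e]) (use fin he in auto)
    then show ?thesis using card_Suc_Diff1[OF fin assms(2)] by simp
  qed
  have finZ: "finite (?Z s e)" for s e
    by (rule finite_subset[of _ "?C \<times> ?U"]) (use fin finite_line_cells[of ?U l] in \<open>auto simp: zone_edges_def\<close>)
  define i where "i = (\<lambda>(\<sigma>, h::form). (insert l \<sigma>, h))"
  have cardI: "card (i ` A) \<le> n" if "card A \<le> n" "finite A" for A n
    using card_image_le[OF that(2), of i] that(1) by simp
  let ?S = "(\<lambda>\<sigma>. (\<sigma>, l)) ` ?C \<union> (\<lambda>\<sigma>. (insert l \<sigma>, l)) ` ?C \<union>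
     i ` ?Z 1 ?e \<union> i ` ?Z 1 (- ?e) \<union> ?Z (-1) ?e \<union> ?Z (-1) (- ?e)"
  have "{(\<sigma>, h). facet W \<sigma> l \<and> facet W \<sigma> h} \<subseteq> ?S"
  proof (rule subsetI)
    fix z assume "z \<in> {(\<sigma>, h). facet W \<sigma> l \<and> facet W \<sigma> h}"
    then obtain \<sigma> h where z: "z = (\<sigma>, h)" and A: "facet W \<sigma> l" "facet W \<sigma> h" by blast
    have c: "\<sigma> - {l} \<in> ?C" using facet_line_cell[OF A(1)] .
    show "z \<in> ?S"
    proof (cases "h = l")
      case True
      have "\<sigma> = \<sigma> - {l} \<or> \<sigma> = insert l (\<sigma> - {l})" by auto
      then show ?thesis using c unfolding z True by blast
    next
      case False
      obtain q where q: "ev h q = 0" "realizes (W - {h}) q \<sigma>" and h: "h \<in> W" using A(2) by (auto simp: facet_def)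
      have lq: "ev l q \<noteq> 0" "ev l q > 0 \<longleftrightarrow> l \<in> \<sigma>" using q(2) False assms(2) by (auto simp: realizes_def)
      have r: "realizes (?U - {h}) q (\<sigma> - {l})" using q(2) by (auto simp: realizes_def)
      define s :: real where "s = (if l \<in> \<sigma> then 1 else -1)"
      have s: "s * ev l q > 0" using lq by (auto simp: s_def)
      have "nrm h \<bullet> ?e \<noteq> 0" using he h False by auto
      then have "(h \<in> \<sigma> - {l} \<longleftrightarrow> nrm h \<bullet> ?e > 0) \<or> (h \<in> \<sigma> - {l} \<longleftrightarrow> nrm h \<bullet> - ?e > 0)" by auto
      then have zz: "(\<sigma> - {l}, h) \<in> ?Z s ?e \<union> ?Z s (- ?e)"
        using c h False s q(1) r unfolding zone_edges_def by blast
      show ?thesis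
      proof (cases "l \<in> \<sigma>")
        case True
        then have "i (\<sigma> - {l}, h) = z" by (auto simp: i_def z)
        then have "z \<in> i ` (?Z s ?e \<union> ?Z s (- ?e))" using zz by (metis image_eqI)
        then show ?thesis using True unfolding s_def by auto
      next
        case False
        then have "\<sigma> - {l} = \<sigma>" by auto
        then show ?thesis using zz False unfolding s_def z by auto
      qed
    qed
  qed
  then have "card {(\<sigma>, h). facet W \<sigma> l \<and> facet W \<sigma> h} \<le> card ?S"
    by (rule card_mono[rotated]) (simp add: finZ finite_line_cells fin)
  also have "\<dots> \<le> card W + card W + 3 * card W + 3 * card W + 3 * card W + 3 * card W"
  proof -
    have finC: "finite ?C" using finite_line_cells[of ?U l] fin by simp
    have C': "card ((\<lambda>\<sigma>. (\<sigma>, l)) ` ?C) \<le> card W" "card ((\<lambda>\<sigma>. (insert l \<sigma>, l)) ` ?C) \<le> card W"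
      by (meson C card_image_le finC order_trans)+
    show ?thesis
      by (intro order_trans[OF card_Un_le] add_mono C' cardI[OF _ finZ] Z)
  qed
  finally show ?thesis by simp
qed

text \<open>The sum counts the triples of a cell and two of its sides. The triples whose first side lies on a given
line are counted by the zone theorem for this line.\<close>

lemma sum_degree_squared:
  assumes "transversal W"
  shows "(\<Sum>\<sigma>\<in>Pow W. (card {h. facet W \<sigma> h})\<^sup>2) \<le> 14 * (card W)\<^sup>2"
proof -
  have fin: "finite W" using assms by (simp add: transversal_def)
  have sub: "{h. facet W \<sigma> h} \<subseteq> W" for \<sigma> by (auto simp: facet_def)
  let ?F = "\<lambda>\<sigma>. {h. facet W \<sigma> h}"
  let ?Z = "\<lambda>l. {(\<sigma>, h). facet W \<sigma> l \<and> facet W \<sigma> h}"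
  have finF: "finite (?F \<sigma>)" for \<sigma> using finite_subset[OF sub fin] .
  have finZ: "finite (?Z l)" for l
    by (rule finite_subset[of _ "Pow W \<times> W"]) (use fin in \<open>auto simp: facet_def\<close>)
  have "(\<Sum>\<sigma>\<in>Pow W. (card (?F \<sigma>))\<^sup>2) = card (SIGMA \<sigma>:Pow W. ?F \<sigma> \<times> ?F \<sigma>)"
    using fin finF by (subst card_SigmaI) (auto simp: power2_eq_square card_cartesian_product)
  also have "\<dots> \<le> card (SIGMA l:W. ?Z l)"
  proof (rule card_inj_on_le[of "\<lambda>(\<sigma>, l, h). (l, \<sigma>, h)"])
    show "(\<lambda>(\<sigma>, l, h). (l, \<sigma>, h)) ` (SIGMA \<sigma>:Pow W. ?F \<sigma> \<times> ?F \<sigma>) \<subseteq> (SIGMA l:W. ?Z l)"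
      by (auto simp: facet_def)
    show "inj_on (\<lambda>(\<sigma>, l, h). (l, \<sigma>, h)) (SIGMA \<sigma>:Pow W. ?F \<sigma> \<times> ?F \<sigma>)"
      by (rule inj_onI) (clarsimp split: prod.splits)
    show "finite (SIGMA l:W. ?Z l)" using fin finZ by (rule finite_SigmaI)
  qed
  also have "\<dots> = (\<Sum>l\<in>W. card (?Z l))" using fin finZ by (subst card_SigmaI) auto
  also have "\<dots> \<le> (\<Sum>l\<in>W. 14 * card W)" using card_zone[OF assms] by (intro sum_mono) auto
  finally show ?thesis by (simp add: power2_eq_square)
qed

section \<open>Lines separating two points\<close>

definition sep :: "form set \<Rightarrow> real^2 \<Rightarrow> real^2 \<Rightarrow> form set" where
  "sep W x y = {w\<in>W. ev w x * ev w y < 0}"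

text \<open>The parameter at which the segment from \<open>x\<close> to \<open>y\<close> meets the line of \<open>w\<close>.\<close>

definition cut_time :: "real^2 \<Rightarrow> real^2 \<Rightarrow> form \<Rightarrow> real" where
  "cut_time x y w = ev w x / (ev w x - ev w y)"

lemma cut_time_bounds:
  assumes "ev w x * ev w y < 0"
  shows "0 < cut_time x y w" "cut_time x y w < 1"
  using assms unfolding cut_time_def by (auto simp: mult_less_0_iff field_simps)

lemma cut_time_zero:
  assumes "ev w x * ev w y < 0"
  shows "ev w (x + cut_time x y w *\<^sub>R (y - x)) = 0"
  using assms unfolding ev_segment cut_time_def by (auto simp: mult_less_0_iff field_simps)

lemma cut_time_sign:
  assumes "ev w x * ev w y < 0"
  shows "ev w (x + t *\<^sub>R (y - x)) * ev w x > 0 \<longleftrightarrow> t < cut_time x y w"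
    and "ev w (x + t *\<^sub>R (y - x)) * ev w x < 0 \<longleftrightarrow> t > cut_time x y w"
proof -
  have p: "ev w x * (ev w x - ev w y) > 0"
    unfolding right_diff_distrib using assms zero_le_square[of "ev w x"] by linarith
  have nz: "ev w x - ev w y \<noteq> 0" using p by auto
  have eq: "ev w (x + t *\<^sub>R (y - x)) * ev w x = (ev w x * (ev w x - ev w y)) * (cut_time x y w - t)"
    unfolding ev_segment cut_time_def using nz by (simp add: field_simps)
  have "c * d > 0 \<longleftrightarrow> d > 0" "c * d < 0 \<longleftrightarrow> d < 0" if "c > 0" for c d :: real
    using that by (simp_all add: zero_less_mult_iff mult_less_0_iff)
  from this[OF p] show "ev w (x + t *\<^sub>R (y - x)) * ev w x > 0 \<longleftrightarrow> t < cut_time x y w"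
    "ev w (x + t *\<^sub>R (y - x)) * ev w x < 0 \<longleftrightarrow> t > cut_time x y w"
    unfolding eq by simp_all
qed

lemma same_side_segment:
  assumes "ev w x * ev w y > 0" "0 \<le> t" "t \<le> 1"
  shows "ev w (x + t *\<^sub>R (y - x)) * ev w x > 0"
proof -
  have "ev w (x + t *\<^sub>R (y - x)) * ev w x = (1 - t) * (ev w x)\<^sup>2 + t * (ev w x * ev w y)"
    unfolding ev_segment by (simp add: algebra_simps power2_eq_square)
  moreover have "(ev w x)\<^sup>2 > 0" using assms(1) by auto
  ultimately show ?thesis using assms
    by (cases "t = 1") (auto simp: mult.commute intro!: add_pos_nonneg)
qed

section \<open>Balls in a graph with bounded second moment of degrees\<close>

lemma relpow_Image_subset:
  assumes "E \<subseteq> V \<times> V" "v \<in> V"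
  shows "((E \<union> Id) ^^ k) `` {v} \<subseteq> V"
proof (induction k)
  case (Suc k)
  then show ?case using assms by auto
qed (use assms in auto)

text \<open>Cauchy-Schwarz: a bounded second moment makes the degrees uniformly integrable.\<close>

lemma sum_degrees_small_set:
  fixes d :: "'v \<Rightarrow> real" and A m \<eta> c :: real
  assumes "finite V" "B \<subseteq> V" "(\<Sum>v\<in>V. (d v)\<^sup>2) \<le> A * m\<^sup>2" "real (card B) \<le> \<eta> * m\<^sup>2" "A \<ge> 0" "\<eta> \<ge> 0"
    "\<eta> * A \<le> c\<^sup>2" "c \<ge> 0"
  shows "(\<Sum>v\<in>B. d v) \<le> c * m\<^sup>2"
proof (rule power2_le_imp_le)
  have "(\<Sum>v\<in>B. d v)\<^sup>2 \<le> (\<Sum>v\<in>B. 1\<^sup>2) * (\<Sum>v\<in>B. (d v)\<^sup>2)"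
    using Cauchy_Schwarz_ineq_sum[of "\<lambda>_. 1" d B] by simp
  also have "\<dots> \<le> (\<eta> * m\<^sup>2) * (A * m\<^sup>2)"
  proof (rule mult_mono)
    show "(\<Sum>v\<in>B. (d v)\<^sup>2) \<le> A * m\<^sup>2"
      using sum_mono2[OF assms(1,2), of "\<lambda>v. (d v)\<^sup>2"] assms(3) by simp
  qed (use assms in \<open>auto simp: sum_nonneg\<close>)
  also have "\<dots> = (\<eta> * A) * (m\<^sup>2)\<^sup>2" by (simp add: power2_eq_square)
  also have "\<dots> \<le> c\<^sup>2 * (m\<^sup>2)\<^sup>2" using assms(7) by (intro mult_right_mono) auto
  finally show "(\<Sum>v\<in>B. d v)\<^sup>2 \<le> (c * m\<^sup>2)\<^sup>2" by (simp add: power_mult_distrib)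
qed (use assms in simp)

text \<open>Induction on the radius. If \<open>v\<close> has degree at most \<open>D\<close> and all its neighbours have small balls of
radius \<open>k\<close>, then its ball of radius \<open>k + 1\<close> is small too. The exceptions are the vertices of large
degree, few by the second moment, and the neighbours of vertices with large balls, few because a small
set has a small neighbourhood.\<close>

lemma few_crowded_vertices:
  fixes A \<delta> :: real
  assumes "A \<ge> 0" "\<delta> > 0"
  shows "\<exists>K::nat. \<forall>(V :: 'v set) E (m::real). finite V \<longrightarrow> E \<subseteq> V \<times> V \<longrightarrow> sym E \<longrightarrow>
     (\<Sum>v\<in>V. (real (card (E `` {v})))\<^sup>2) \<le> A * m\<^sup>2 \<longrightarrow>
     real (card {v\<in>V. card (((E \<union> Id) ^^ k) `` {v}) > K}) \<le> \<delta> * m\<^sup>2"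
  using assms(2)
proof (induction k arbitrary: \<delta>)
  case 0
  then show ?case by (intro exI[of _ 1]) simp
next
  case (Suc k)
  \<comment> \<open>The factor is small enough that both the set \<open>B\<close> and its neighbourhood
    have at most \<open>\<delta> / 4 * m\<^sup>2\<close> elements.\<close>
  define \<eta> where "\<eta> = min (\<delta> / 4) (\<delta>\<^sup>2 / (16 * (A + 1)))"
  have \<eta>: "\<eta> > 0" using Suc.prems assms(1) by (simp add: \<eta>_def)
  have \<eta>4: "\<eta> \<le> \<delta> / 4" unfolding \<eta>_def by (rule min.cobounded1)
  have "\<eta> * A \<le> \<delta>\<^sup>2 / (16 * (A + 1)) * A" using assms(1) by (intro mult_right_mono) (auto simp: \<eta>_def)
  also have "\<dots> \<le> (\<delta> / 4)\<^sup>2" using assms(1) by (simp add: field_simps power2_eq_square)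
  finally have \<eta>A: "\<eta> * A \<le> (\<delta> / 4)\<^sup>2" .
  obtain K where K: "\<And>(V :: 'v set) E (m::real). finite V \<Longrightarrow> E \<subseteq> V \<times> V \<Longrightarrow> sym E \<Longrightarrow>
     (\<Sum>v\<in>V. (real (card (E `` {v})))\<^sup>2) \<le> A * m\<^sup>2 \<Longrightarrow>
     real (card {v\<in>V. card (((E \<union> Id) ^^ k) `` {v}) > K}) \<le> \<eta> * m\<^sup>2"
    using Suc.IH[OF \<eta>] by blast
  obtain D :: nat where "2 * A / \<delta> + 1 < real D" using reals_Archimedean2 by blast
  moreover from this have "real D \<ge> 1" using assms(1) Suc.prems by (smt (verit) divide_nonneg_pos)
  moreover from this have "real D \<le> (real D)\<^sup>2"
    using mult_left_mono[of 1 "real D" "real D"] by (simp add: power2_eq_square)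
  ultimately have D: "2 * A / \<delta> \<le> (real D)\<^sup>2" "D \<ge> 1" by linarith+
  show ?case
  proof (intro exI[of _ "(D + 1) * K"] allI impI)
    fix V :: "'v set" and E and m :: real
    assume fin: "finite V" and E: "E \<subseteq> V \<times> V" "sym E" and deg: "(\<Sum>v\<in>V. (real (card (E `` {v})))\<^sup>2) \<le> A * m\<^sup>2"
    let ?R = "E \<union> Id"
    define B where "B = {v\<in>V. card ((?R ^^ k) `` {v}) > K}"
    define T where "T = {v\<in>V. card (E `` {v}) > D}"
    have B: "real (card B) \<le> \<eta> * m\<^sup>2" unfolding B_def by (rule K[OF fin E deg])
    have finB: "finite B" "finite T" "B \<subseteq> V" using fin by (auto simp: B_def T_def)
    have finE: "finite (E `` {v})" for v using E(1) fin by (auto intro: finite_subset[of _ V])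
    have "real (card T) * (real D)\<^sup>2 \<le> (\<Sum>v\<in>T. (real (card (E `` {v})))\<^sup>2)"
      using sum_bounded_below[of T "(real D)\<^sup>2" "\<lambda>v. (real (card (E `` {v})))\<^sup>2"] by (simp add: T_def)
    also have "\<dots> \<le> A * m\<^sup>2"
      using sum_mono2[OF fin, of T "\<lambda>v. (real (card (E `` {v})))\<^sup>2"] deg by (auto simp: T_def)
    finally have "real (card T) * (2 * A / \<delta>) \<le> A * m\<^sup>2"
      using D(1) mult_left_mono[of "2 * A / \<delta>" "(real D)\<^sup>2" "real (card T)"] by linarith
    have T: "real (card T) \<le> \<delta> / 2 * m\<^sup>2"
    proof (cases "A = 0")
      case True
      have "real (card T) * (real D)\<^sup>2 \<le> 0"
        using \<open>real (card T) * (real D)\<^sup>2 \<le> (\<Sum>v\<in>T. (real (card (E `` {v})))\<^sup>2)\<close>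
          \<open>(\<Sum>v\<in>T. (real (card (E `` {v})))\<^sup>2) \<le> A * m\<^sup>2\<close> True by simp
      then have "card T = 0" using D(2) by (auto simp: mult_le_0_iff)
      then show ?thesis using Suc.prems by simp
    next
      case False
      then have "A > 0" using assms(1) by simp
      then show ?thesis using \<open>real (card T) * (2 * A / \<delta>) \<le> A * m\<^sup>2\<close> Suc.prems by (simp add: field_simps)
    qed
    have "real (card (E `` B)) \<le> (\<Sum>v\<in>B. real (card (E `` {v})))"
    proof -
      have "E `` B = (\<Union>v\<in>B. E `` {v})" by auto
      then have "card (E `` B) \<le> (\<Sum>v\<in>B. card (E `` {v}))" using card_UN_le[OF finB(1)] by metis
      then show ?thesis by (metis of_nat_mono of_nat_sum)
    qed
    also have "\<dots> \<le> \<delta> / 4 * m\<^sup>2"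
      by (rule sum_degrees_small_set[OF fin finB(3) deg B assms(1) _ \<eta>A]) (use \<eta> Suc.prems in auto)
    finally have EB: "real (card (E `` B)) \<le> \<delta> / 4 * m\<^sup>2" .
    have "{v\<in>V. card ((?R ^^ Suc k) `` {v}) > (D + 1) * K} \<subseteq> T \<union> B \<union> E `` B"
    proof (rule subsetI, rule ccontr)
      fix v assume v: "v \<in> {v\<in>V. card ((?R ^^ Suc k) `` {v}) > (D + 1) * K}" "v \<notin> T \<union> B \<union> E `` B"
      have nb: "card (?R `` {v}) \<le> D + 1"
      proof -
        have "?R `` {v} = insert v (E `` {v})" by auto
        then show ?thesis using v finE card_insert_le_m1[of "D + 1" "E `` {v}" v] by (auto simp: T_def)
      qed
      have "card ((?R ^^ k) `` {u}) \<le> K" if "u \<in> ?R `` {v}" for u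
      proof -
        have "u \<in> V" "u \<notin> B" using that v E by (auto dest: symD)
        then show ?thesis by (auto simp: B_def)
      qed
      then have "(\<Sum>u\<in>?R `` {v}. card ((?R ^^ k) `` {u})) \<le> card (?R `` {v}) * K"
        using sum_bounded_above[of "?R `` {v}" "\<lambda>u. card ((?R ^^ k) `` {u})" K] by simp
      also have "\<dots> \<le> (D + 1) * K" using nb by (rule mult_le_mono1)
      finally have sum: "(\<Sum>u\<in>?R `` {v}. card ((?R ^^ k) `` {u})) \<le> (D + 1) * K" .
      have eq: "(?R ^^ Suc k) `` {v} = (\<Union>u\<in>?R `` {v}. (?R ^^ k) `` {u})"
        unfolding relpow.simps relpow_commute[symmetric] by blast
      have "finite (?R `` {v})" using finE[of v] by (simp add: Un_Image)
      from card_UN_le[OF this] sum have "card ((?R ^^ Suc k) `` {v}) \<le> (D + 1) * K"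
        unfolding eq by (rule order_trans)
      then show False using v by simp
    qed
    moreover have "finite (E `` B)" using E(1) fin by (auto intro: finite_subset[of _ V])
    ultimately have "card {v\<in>V. card ((?R ^^ Suc k) `` {v}) > (D + 1) * K} \<le> card (T \<union> B \<union> E `` B)"
      using finB by (intro card_mono) auto
    also have "\<dots> \<le> card T + card B + card (E `` B)"
      using card_Un_le[of "T \<union> B" "E `` B"] card_Un_le[of T B] by linarith
    finally have "real (card {v\<in>V. card ((?R ^^ Suc k) `` {v}) > (D + 1) * K}) \<le> real (card T) + real (card B) + real (card (E `` B))"
      by linarith
    also have "\<dots> \<le> \<delta> / 2 * m\<^sup>2 + \<delta> / 4 * m\<^sup>2 + \<delta> / 4 * m\<^sup>2"
    proof -
      have "\<eta> * m\<^sup>2 \<le> \<delta> / 4 * m\<^sup>2" using \<eta>4 by (intro mult_right_mono) auto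
      then show ?thesis using T B EB by linarith
    qed
    finally show "real (card {v\<in>V. card ((?R ^^ Suc k) `` {v}) > (D + 1) * K}) \<le> \<delta> * m\<^sup>2" by simp
  qed
qed

section \<open>Walking along a segment\<close>

definition pos :: "form set \<Rightarrow> real^2 \<Rightarrow> form set" where
  "pos W x = {w\<in>W. ev w x > 0}"

definition flip :: "form \<Rightarrow> form set \<Rightarrow> form set" where
  "flip h \<sigma> = (if h \<in> \<sigma> then \<sigma> - {h} else insert h \<sigma>)"

text \<open>Two cells are adjacent if they share a side.\<close>

definition cell_graph :: "form set \<Rightarrow> (form set \<times> form set) set" where
  "cell_graph W = {(\<sigma>, flip h \<sigma>) | \<sigma> h. facet W \<sigma> h}"

lemma flip_flip [simp]: "flip h (flip h \<sigma>) = \<sigma>"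
  by (auto simp: flip_def)

lemma facet_flip: "facet W \<sigma> h \<Longrightarrow> facet W (flip h \<sigma>) h"
  unfolding facet_def realizes_def flip_def by auto

lemma cell_graph_subset: "cell_graph W \<subseteq> Pow W \<times> Pow W"
  unfolding cell_graph_def using facet_flip by (auto simp: facet_def)

lemma sym_cell_graph: "sym (cell_graph W)"
  by (rule symI) (use facet_flip flip_flip in \<open>unfold cell_graph_def, blast\<close>)

lemma cell_graph_degrees:
  assumes "transversal W"
  shows "(\<Sum>\<sigma>\<in>Pow W. (real (card (cell_graph W `` {\<sigma>})))\<^sup>2) \<le> 14 * (real (card W))\<^sup>2"
proof -
  have fin: "finite W" using assms by (simp add: transversal_def)
  have "card (cell_graph W `` {\<sigma>}) \<le> card {h. facet W \<sigma> h}" for \<sigma>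
  proof -
    have "cell_graph W `` {\<sigma>} = (\<lambda>h. flip h \<sigma>) ` {h. facet W \<sigma> h}" by (auto simp: cell_graph_def)
    moreover have "finite {h. facet W \<sigma> h}" by (rule finite_subset[OF _ fin]) (auto simp: facet_def)
    ultimately show ?thesis using card_image_le by metis
  qed
  then have "(\<Sum>\<sigma>\<in>Pow W. (card (cell_graph W `` {\<sigma>}))\<^sup>2) \<le> (\<Sum>\<sigma>\<in>Pow W. (card {h. facet W \<sigma> h})\<^sup>2)"
    by (intro sum_mono power_mono) auto
  also have "\<dots> \<le> 14 * (card W)\<^sup>2" by (rule sum_degree_squared[OF assms])
  finally have "real (\<Sum>\<sigma>\<in>Pow W. (card (cell_graph W `` {\<sigma>}))\<^sup>2) \<le> real (14 * (card W)\<^sup>2)"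
    by (rule of_nat_mono)
  then show ?thesis by simp
qed

text \<open>The distance in the cell graph is at most the number of separating lines: the segment from \<open>x\<close> to \<open>y\<close>
crosses the separating lines one at a time, and each crossing is a step to an adjacent cell. The
induction replaces \<open>x\<close> by a point just after the first crossing.\<close>

lemma segment_walk:
  assumes "finite W" "\<And>w. w \<in> W \<Longrightarrow> ev w x \<noteq> 0 \<and> ev w y \<noteq> 0"
    "\<And>v w. v \<in> W \<Longrightarrow> w \<in> W \<Longrightarrow> v \<noteq> w \<Longrightarrow> ev v x * ev w y \<noteq> ev w x * ev v y"
    "card (sep W x y) \<le> k"
  shows "(pos W x, pos W y) \<in> (cell_graph W \<union> Id) ^^ k"
  using assms(2-4)
proof (induction k arbitrary: x)
  case 0
  have "sep W x y = {}" using 0(3) assms(1) by (simp add: sep_def)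
  then have "pos W x = pos W y" using 0(1)
    by (auto simp: sep_def pos_def mult_less_0_iff) (metis linorder_neqE_linordered_idom)+
  then show ?case by simp
next
  case (Suc k)
  show ?case
  proof (cases "sep W x y = {}")
    case True
    then have "(pos W x, pos W y) \<in> (cell_graph W \<union> Id) ^^ k"
      using Suc.IH[OF Suc.prems(1,2)] by simp
    then show ?thesis by auto
  next
    case False
    let ?t = "cut_time x y"
    let ?p = "\<lambda>t. x + t *\<^sub>R (y - x)"
    have fin: "finite (sep W x y)" using assms(1) by (simp add: sep_def)
    obtain g where g: "g \<in> sep W x y" "\<And>w. w \<in> sep W x y \<Longrightarrow> ?t g \<le> ?t w"
      using ex_is_arg_min_if_finite[OF fin False, of ?t] unfolding is_arg_min_linorder by auto
    have gs: "g \<in> W" "ev g x * ev g y < 0" using g(1) by (auto simp: sep_def)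
    have tne: "?t w \<noteq> ?t g" if w: "w \<in> sep W x y" "w \<noteq> g" for w
    proof
      assume "?t w = ?t g"
      moreover have "ev w x * ev w y < 0" "w \<in> W" using w by (auto simp: sep_def)
      moreover have "ev w x - ev w y \<noteq> 0" "ev g x - ev g y \<noteq> 0"
        using gs(2) \<open>ev w x * ev w y < 0\<close> by (auto simp: mult_less_0_iff)
      ultimately have "ev w x * (ev g x - ev g y) = ev g x * (ev w x - ev w y)"
        unfolding cut_time_def by (simp add: frac_eq_eq)
      then have "ev w x * ev g y = ev g x * ev w y" by (simp add: algebra_simps)
      then show False using Suc.prems(2)[of w g] \<open>w \<in> W\<close> gs(1) w(2) by blast
    qed
    \<comment> \<open>No other separating line is crossed before the parameter \<open>m\<close>.\<close>
    define m where "m = Min (insert 1 (?t ` (sep W x y - {g})))"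
    have "?t g < 1" using cut_time_bounds(2)[OF gs(2)] .
    moreover have "?t g < ?t w" if "w \<in> sep W x y - {g}" for w
      using g(2)[of w] tne[of w] that by (simp add: order_less_le)
    ultimately have "?t g < m" unfolding m_def using fin by (subst Min_gr_iff) auto
    then obtain s where s: "?t g < s" "s < m" using dense by blast
    have s1: "s < 1" "0 < s" using s cut_time_bounds(1)[OF gs(2)] Min_le[of "insert 1 (?t ` (sep W x y - {g}))" 1] fin
      by (auto simp: m_def)
    have sw: "s < ?t w" if "w \<in> sep W x y" "w \<noteq> g" for w
    proof -
      have "m \<le> ?t w" unfolding m_def using that fin by (intro Min_le) auto
      then show ?thesis using s by simp
    qed
    have side: "ev w (?p t) * ev w x > 0" if "w \<in> W" "w \<noteq> g" "0 \<le> t" "t \<le> s" for w t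
    proof (cases "w \<in> sep W x y")
      case True
      then show ?thesis using sw[OF True that(2)] that cut_time_sign(1)[of w x y t] by (auto simp: sep_def)
    next
      case False
      then have "ev w x * ev w y > 0" using Suc.prems(1)[OF that(1)] that(1)
        by (simp add: sep_def not_less order_less_le)
      then show ?thesis using same_side_segment that s1 by simp
    qed
    have gx: "ev g (?p s) * ev g x < 0" using cut_time_sign(2)[OF gs(2)] s by simp
    have pos': "pos W (?p s) = flip g (pos W x)"
    proof -
      have "ev w (?p s) > 0 \<longleftrightarrow> ev w x > 0" if "w \<in> W" "w \<noteq> g" for w
        using side[of w s] that s1 by (auto simp: zero_less_mult_iff)
      moreover have "ev g (?p s) > 0 \<longleftrightarrow> \<not> ev g x > 0" using gx by (auto simp: mult_less_0_iff)
      ultimately show ?thesis using gs(1) unfolding pos_def flip_def by auto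
    qed
    have "facet W (pos W x) g"
      unfolding facet_def realizes_def
    proof (intro conjI exI[of _ "?p (?t g)"] ballI)
      show "ev g (?p (?t g)) = 0" by (rule cut_time_zero[OF gs(2)])
      fix w assume "w \<in> W - {g}"
      then have *: "w \<in> W" "ev w (?p (?t g)) * ev w x > 0"
        using side[of w "?t g"] s cut_time_bounds(1)[OF gs(2)] by auto
      then show "ev w (?p (?t g)) \<noteq> 0" by auto
      show "ev w (?p (?t g)) > 0 \<longleftrightarrow> w \<in> pos W x" using * by (auto simp: pos_def zero_less_mult_iff)
    qed (use gs in \<open>auto simp: pos_def\<close>)
    then have step: "(pos W x, pos W (?p s)) \<in> cell_graph W" unfolding pos' cell_graph_def by blast
    have "(pos W (?p s), pos W y) \<in> (cell_graph W \<union> Id) ^^ k"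
    proof (rule Suc.IH)
      show "ev w (?p s) \<noteq> 0 \<and> ev w y \<noteq> 0" if "w \<in> W" for w
        using side[OF that, of s] s1 gx Suc.prems(1)[OF that] by (cases "w = g") auto
      show "ev v (?p s) * ev w y \<noteq> ev w (?p s) * ev v y" if "v \<in> W" "w \<in> W" "v \<noteq> w" for v w
      proof -
        have "ev v (?p s) * ev w y - ev w (?p s) * ev v y = (1 - s) * (ev v x * ev w y - ev w x * ev v y)"
          unfolding ev_segment by (simp add: algebra_simps)
        then show ?thesis using Suc.prems(2)[OF that] s1 by auto
      qed
      have "sep W (?p s) y \<subseteq> sep W x y - {g}"
      proof
        fix w assume w: "w \<in> sep W (?p s) y"
        have "w \<noteq> g" using w gx gs(2) by (auto simp: sep_def mult_less_0_iff)
        then show "w \<in> sep W x y - {g}" using w side[of w s] s1 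
          by (auto simp: sep_def mult_less_0_iff zero_less_mult_iff)
      qed
      then have "card (sep W (?p s) y) \<le> card (sep W x y - {g})" using fin by (intro card_mono) auto
      then show "card (sep W (?p s) y) \<le> k" using Suc.prems(3) g(1) fin by simp
    qed
    then show ?thesis using step by (metis UnI1 relpow_Suc_I2)
  qed
qed

lemma inj_on_pos:
  assumes "\<And>x y. x \<in> P \<Longrightarrow> y \<in> P \<Longrightarrow> x \<noteq> y \<Longrightarrow> sep W x y \<noteq> {}"
  shows "inj_on (pos W) P"
proof (rule inj_onI, rule ccontr)
  fix x y assume "x \<in> P" "y \<in> P" "pos W x = pos W y" "x \<noteq> y"
  then obtain w where "w \<in> W" "ev w x * ev w y < 0" using assms unfolding sep_def by blast
  moreover have "w \<in> pos W x \<longleftrightarrow> w \<in> pos W y" using \<open>pos W x = pos W y\<close> by simp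
  ultimately show False by (auto simp: pos_def mult_less_0_iff)
qed

text \<open>Points in different cells have different sign patterns, and points separated by few lines
are close in the cell graph, where few vertices have large balls.\<close>

lemma few_crowded_points_general_position:
  fixes \<delta> :: real
  assumes "\<delta> > 0"
  shows "\<exists>K::nat. \<forall>W P. transversal W \<longrightarrow> crossed_separately W P \<longrightarrow> finite P \<longrightarrow> (\<forall>w\<in>W. \<forall>x\<in>P. ev w x \<noteq> 0) \<longrightarrow>
    (\<forall>x\<in>P. \<forall>y\<in>P. x \<noteq> y \<longrightarrow> sep W x y \<noteq> {}) \<longrightarrow>
    real (card {x\<in>P. card {y\<in>P. card (sep W x y) \<le> k} > K}) \<le> \<delta> * (real (card W))\<^sup>2"
proof -
  have "(0::real) \<le> 14" by simp
  from few_crowded_vertices[OF this assms, of k]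
  obtain K where K: "\<And>(V :: form set set) E (m::real). finite V \<Longrightarrow> E \<subseteq> V \<times> V \<Longrightarrow> sym E \<Longrightarrow>
     (\<Sum>v\<in>V. (real (card (E `` {v})))\<^sup>2) \<le> 14 * m\<^sup>2 \<Longrightarrow>
     real (card {v\<in>V. card (((E \<union> Id) ^^ k) `` {v}) > K}) \<le> \<delta> * m\<^sup>2"
    by blast
  show ?thesis
  proof (intro exI[of _ K] allI impI)
    fix W P assume W: "transversal W" "crossed_separately W P" and P: "finite P" "\<forall>w\<in>W. \<forall>x\<in>P. ev w x \<noteq> 0"
      "\<forall>x\<in>P. \<forall>y\<in>P. x \<noteq> y \<longrightarrow> sep W x y \<noteq> {}"
    have fin: "finite W" using W by (simp add: transversal_def)
    let ?R = "cell_graph W \<union> Id"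
    have inj: "inj_on (pos W) P" by (rule inj_on_pos) (use P(3) in blast)
    have pow: "pos W x \<in> Pow W" for x by (auto simp: pos_def)
    have ball: "card {y\<in>P. card (sep W x y) \<le> k} \<le> card ((?R ^^ k) `` {pos W x})" if x: "x \<in> P" for x
    proof (rule card_inj_on_le[of "pos W"])
      show "inj_on (pos W) {y\<in>P. card (sep W x y) \<le> k}" using inj by (rule inj_on_subset) auto
      show "finite ((?R ^^ k) `` {pos W x})"
        using finite_subset[OF relpow_Image_subset[OF cell_graph_subset pow]] fin by simp
      show "pos W ` {y\<in>P. card (sep W x y) \<le> k} \<subseteq> (?R ^^ k) `` {pos W x}"
      proof (rule image_subsetI)
        fix y assume y: "y \<in> {y\<in>P. card (sep W x y) \<le> k}"
        show "pos W y \<in> (?R ^^ k) `` {pos W x}"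
        proof (cases "x = y")
          case True
          have "(pos W x, pos W x) \<in> ?R ^^ k" by (induction k) auto
          then show ?thesis using True by simp
        next
          case False
          have "(pos W x, pos W y) \<in> ?R ^^ k"
            by (rule segment_walk[OF fin]) (use x y False P W(2) in \<open>auto simp: crossed_separately_def\<close>)
          then show ?thesis by simp
        qed
      qed
    qed
    have "card {x\<in>P. card {y\<in>P. card (sep W x y) \<le> k} > K} \<le> card {v\<in>Pow W. card ((?R ^^ k) `` {v}) > K}"
    proof (rule card_inj_on_le[of "pos W"])
      show "inj_on (pos W) {x\<in>P. card {y\<in>P. card (sep W x y) \<le> k} > K}" using inj by (rule inj_on_subset) auto
      show "pos W ` {x\<in>P. card {y\<in>P. card (sep W x y) \<le> k} > K} \<subseteq> {v\<in>Pow W. card ((?R ^^ k) `` {v}) > K}"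
      proof (rule image_subsetI)
        fix x assume "x \<in> {x\<in>P. card {y\<in>P. card (sep W x y) \<le> k} > K}"
        then show "pos W x \<in> {v\<in>Pow W. card ((?R ^^ k) `` {v}) > K}"
          using ball[of x] pow[of x] by simp
      qed
    qed (use fin in auto)
    also have "real \<dots> \<le> \<delta> * (real (card W))\<^sup>2"
      by (rule K) (use fin cell_graph_subset sym_cell_graph cell_graph_degrees[OF W(1)] in auto)
    finally show "real (card {x\<in>P. card {y\<in>P. card (sep W x y) \<le> k} > K}) \<le> \<delta> * (real (card W))\<^sup>2"
      by simp
  qed
qed

section \<open>A packing bound by vertices\<close>

text \<open>Ties only help: an element is counted if fewer than \<open>r\<close> elements are strictly smaller.\<close>

lemma card_low_rank:
  fixes f :: "'a \<Rightarrow> real"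
  assumes "finite A" "r \<le> card A"
  shows "r \<le> card {a\<in>A. card {b\<in>A. f b < f a} < r}"
  using assms(2)
proof (induction r)
  case (Suc r)
  let ?X = "\<lambda>r. {a\<in>A. card {b\<in>A. f b < f a} < r}"
  have fin: "finite (?X r)" for r using assms(1) by simp
  have sub: "?X r \<subseteq> ?X (Suc r)" by auto
  show ?case
  proof (cases "A - ?X r = {}")
    case True
    then have "?X (Suc r) = A" using sub by blast
    then show ?thesis using Suc.prems by simp
  next
    case False
    obtain a where a: "a \<in> A - ?X r" "\<And>b. b \<in> A - ?X r \<Longrightarrow> f a \<le> f b"
      using ex_is_arg_min_if_finite[OF _ False, of f] assms(1) unfolding is_arg_min_linorder by auto
    show ?thesis
    proof (cases "card (?X r) = r")
      case True
      have "{b\<in>A. f b < f a} \<subseteq> ?X r"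
      proof
        fix b assume b: "b \<in> {b\<in>A. f b < f a}"
        show "b \<in> ?X r"
        proof (rule ccontr)
          assume "b \<notin> ?X r"
          then have "f a \<le> f b" using a(2) b by blast
          then show False using b by simp
        qed
      qed
      from card_mono[OF fin[of r] this] True have "card {b\<in>A. f b < f a} \<le> r" by simp
      then have "insert a (?X r) \<subseteq> ?X (Suc r)" using a(1) by auto
      then have "card (insert a (?X r)) \<le> card (?X (Suc r))" by (rule card_mono[OF fin[of "Suc r"]])
      then show ?thesis using a(1) True fin by simp
    next
      case False
      then show ?thesis using Suc card_mono[OF fin[of "Suc r"] sub] by simp
    qed
  qed
qed simp

definition vertices_near :: "form set \<Rightarrow> real^2 \<Rightarrow> nat \<Rightarrow> (form \<times> form) set" where
  "vertices_near W x d = {(h, g). h \<in> W \<and> g \<in> W \<and> h \<noteq> g \<and>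
     (\<exists>z. ev h z = 0 \<and> ev g z = 0 \<and> card (sep W x z) \<le> d)}"

text \<open>Walk from \<open>x\<close> towards \<open>y\<close>. Each of the first \<open>r\<close> lines that are crossed is reached at the cost of
fewer than \<open>r\<close> lines, and along it the \<open>r\<close> crossings nearest to the entry point \<open>q\<close> are reached at the
cost of fewer than \<open>r\<close> further lines. A vertex is recorded as the pair of the two lines, so that no
two pairs of steps give the same one.\<close>

lemma card_vertices_near:
  assumes W: "transversal W" and r: "r < card W" "0 < r" "r \<le> card (sep W x y)"
    and y: "\<And>w. w \<in> W \<Longrightarrow> ev w y \<noteq> 0"
  shows "r\<^sup>2 \<le> card (vertices_near W x (2 * r - 2))"
proof -
  have fin: "finite W" using W by (simp add: transversal_def)
  have finS: "finite (sep W x y)" using fin by (simp add: sep_def)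
  let ?t = "cut_time x y"
  define q where "q = (\<lambda>h. x + ?t h *\<^sub>R (y - x))"
  \<comment> \<open>The line of \<open>w\<close> meets the line of \<open>h\<close> at signed distance
    proportional to \<open>s h w\<close> from \<open>q h\<close>.\<close>
  define s where "s = (\<lambda>h w. - ev w (q h) / (nrm w \<bullet> dir h))"
  define H where "H = {h\<in>sep W x y. card {b\<in>sep W x y. ?t b < ?t h} < r}"
  define G where "G = (\<lambda>h. {g\<in>W - {h}. card {b\<in>W - {h}. \<bar>s h b\<bar> < \<bar>s h g\<bar>} < r})"
  have H: "r \<le> card H" "finite H" unfolding H_def using card_low_rank[OF finS r(3), of ?t] finS by auto
  have G: "r \<le> card (G h)" "finite (G h)" if "h \<in> H" for h
  proof -
    have "h \<in> W" using that by (simp add: H_def sep_def)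
    then have "r \<le> card (W - {h})" using r(1) fin by simp
    then show "r \<le> card (G h)" unfolding G_def using fin card_low_rank[of "W - {h}" r "\<lambda>g. \<bar>s h g\<bar>"] by simp
    show "finite (G h)" using fin by (simp add: G_def)
  qed
  have "(SIGMA h:H. G h) \<subseteq> vertices_near W x (2 * r - 2)"
  proof (rule subsetI)
    fix p assume "p \<in> (SIGMA h:H. G h)"
    then obtain h g where p: "p = (h, g)" and h: "h \<in> H" and g: "g \<in> G h" by blast
    have hW: "h \<in> W" "ev h x * ev h y < 0" using h by (auto simp: H_def sep_def)
    have gW: "g \<in> W" "g \<noteq> h" using g by (auto simp: G_def)
    have nd: "nrm w \<bullet> dir h \<noteq> 0" if "w \<in> W - {h}" for w
    proof -
      have "w \<in> W" "h \<noteq> w" using that by auto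
      then show ?thesis unfolding inner_dir using W hW(1) unfolding transversal_def by blast
    qed
    define z where "z = q h + s h g *\<^sub>R dir h"
    have z: "ev h z = 0" "ev g z = 0"
    proof -
      have "ev h (q h) = 0" unfolding q_def by (rule cut_time_zero[OF hW(2)])
      then show "ev h z = 0" unfolding z_def ev_move by (simp add: inner_dir)
      show "ev g z = 0" unfolding z_def ev_move s_def using nd[of g] gW by simp
    qed
    have ev: "ev w z = (nrm w \<bullet> dir h) * (s h g - s h w)" "ev w (q h) = - (nrm w \<bullet> dir h) * s h w"
      if "w \<in> W - {h}" for w
      unfolding z_def ev_move s_def using nd[OF that] by (simp_all add: field_simps)
    let ?A1 = "{b\<in>sep W x y. ?t b < ?t h}" and ?A2 = "{b\<in>W - {h}. \<bar>s h b\<bar> < \<bar>s h g\<bar>}"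
    have "sep W x z \<subseteq> ?A1 \<union> ?A2"
    proof (rule subsetI)
      fix w assume "w \<in> sep W x z"
      then have w: "w \<in> W" "ev w x * ev w z < 0" by (auto simp: sep_def)
      have wh: "w \<in> W - {h}" using w z(1) by auto
      show "w \<in> ?A1 \<union> ?A2"
      proof (cases "ev w x * ev w (q h) < 0")
        case True
        have b: "0 < ?t h" "?t h < 1" using cut_time_bounds[OF hW(2)] by auto
        have "\<not> ev w x * ev w y > 0"
          using same_side_segment[of w x y "?t h"] b True by (auto simp: q_def mult.commute)
        then have lt: "ev w x * ev w y < 0" using w y[OF w(1)] by (auto simp: mult_less_0_iff zero_less_mult_iff)
        then have "?t w < ?t h" using cut_time_sign(2)[OF lt, of "?t h"] True by (simp add: q_def mult.commute)
        then show ?thesis using lt w(1) by (simp add: sep_def)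
      next
        case False
        then have le: "ev w z * ev w (q h) \<le> 0" and nz: "ev w z \<noteq> 0"
          using w(2) by (auto simp: mult_less_0_iff mult_le_0_iff)
        let ?b = "nrm w \<bullet> dir h"
        have "ev w z * ev w (q h) = - (?b\<^sup>2 * (s h w * (s h g - s h w)))"
          unfolding ev[OF wh] by (simp add: power2_eq_square)
        then have "?b\<^sup>2 * (s h w * (s h g - s h w)) \<ge> 0" using le by simp
        then have m: "s h w * (s h g - s h w) \<ge> 0" using nd[OF wh] by (simp add: zero_le_mult_iff)
        have "s h g \<noteq> s h w" using nz ev(1)[OF wh] by auto
        then have "\<bar>s h w\<bar> < \<bar>s h g\<bar>" using m by (auto simp: zero_le_mult_iff abs_if)
        then show ?thesis using wh by simp
      qed
    qed
    then have "card (sep W x z) \<le> card (?A1 \<union> ?A2)" using finS fin by (intro card_mono) auto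
    also have "\<dots> \<le> card ?A1 + card ?A2" by (rule card_Un_le)
    also have "\<dots> \<le> 2 * r - 2"
    proof -
      have "card ?A1 < r" using h unfolding H_def by blast
      moreover have "card ?A2 < r" using g unfolding G_def by blast
      ultimately show ?thesis by linarith
    qed
    finally show "p \<in> vertices_near W x (2 * r - 2)"
      unfolding p vertices_near_def using z hW(1) gW by blast
  qed
  moreover have "finite (vertices_near W x (2 * r - 2))"
    by (rule finite_subset[of _ "W \<times> W"]) (use fin in \<open>auto simp: vertices_near_def\<close>)
  ultimately have "card (SIGMA h:H. G h) \<le> card (vertices_near W x (2 * r - 2))" by (rule card_mono[rotated])
  moreover have "card (SIGMA h:H. G h) = (\<Sum>h\<in>H. card (G h))" using H G by (intro card_SigmaI) auto
  moreover have "(\<Sum>h\<in>H. card (G h)) \<ge> card H * r"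
    using sum_bounded_below[of H r "\<lambda>h. card (G h)"] G by simp
  moreover have "card H * r \<ge> r\<^sup>2" using H by (simp add: power2_eq_square)
  ultimately show ?thesis by linarith
qed

text \<open>The sets of vertices near different points of \<open>S\<close> are disjoint: a line separating two points with a
common near vertex separates one of them from the vertex or passes through it, and only two lines
pass through a vertex. The distance would be at most \<open>2 (2 r - 2) + 2 < 4 r\<close>.\<close>

lemma packing:
  assumes W: "transversal W" "no_three_concurrent W" and r: "r < card W" "0 < r"
    and S: "finite S" "\<And>w x. w \<in> W \<Longrightarrow> x \<in> S \<Longrightarrow> ev w x \<noteq> 0"
    and far: "\<And>x y. x \<in> S \<Longrightarrow> y \<in> S \<Longrightarrow> x \<noteq> y \<Longrightarrow> 4 * r \<le> card (sep W x y)"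
  shows "card S * r\<^sup>2 \<le> (card W)\<^sup>2"
proof (cases "card S \<le> 1")
  case True
  then have "card S * r\<^sup>2 \<le> 1 * r\<^sup>2" by (rule mult_le_mono1)
  also have "\<dots> \<le> (card W)\<^sup>2" using r(1) by (simp add: power_mono)
  finally show ?thesis .
next
  case False
  have fin: "finite W" using W by (simp add: transversal_def)
  let ?V = "\<lambda>x. vertices_near W x (2 * r - 2)"
  have sub: "?V x \<subseteq> W \<times> W" for x by (auto simp: vertices_near_def)
  have finV: "finite (?V x)" for x using finite_subset[OF sub] fin by simp
  have large: "r\<^sup>2 \<le> card (?V x)" if x: "x \<in> S" for x
  proof -
    obtain y where y: "y \<in> S" "y \<noteq> x"
    proof (rule ccontr)
      assume "\<not> thesis"
      then have "S \<subseteq> {x}" using that by blast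
      then show False using False card_mono[of "{x}" S] by simp
    qed
    show ?thesis by (rule card_vertices_near[OF W(1) r, of x y]) (use far[OF x y(1)] y S in auto)
  qed
  have disj: "?V x \<inter> ?V y = {}" if xy: "x \<in> S" "y \<in> S" "x \<noteq> y" for x y
  proof (rule ccontr)
    assume "?V x \<inter> ?V y \<noteq> {}"
    then obtain h g z z' where hg: "h \<in> W" "g \<in> W" "h \<noteq> g" and z: "ev h z = 0" "ev g z = 0" "card (sep W x z) \<le> 2 * r - 2"
      and z': "ev h z' = 0" "ev g z' = 0" "card (sep W y z') \<le> 2 * r - 2"
      unfolding vertices_near_def by blast
    have "det2 (nrm h) (nrm g) \<noteq> 0" using W(1) hg by (simp add: transversal_def)
    then have zz: "z' = z" using crossing_unique[of h g z' z] z z' by blast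
    have "sep W x y \<subseteq> sep W x z \<union> sep W y z \<union> {h, g}"
    proof
      fix w assume w: "w \<in> sep W x y"
      then have "w \<in> {h, g}" if "ev w z = 0"
        using W(2) hg z that unfolding no_three_concurrent_def sep_def by blast
      moreover have "w \<in> sep W x z \<union> sep W y z" if "ev w z \<noteq> 0"
        using w that by (auto simp: sep_def mult_less_0_iff)
      ultimately show "w \<in> sep W x z \<union> sep W y z \<union> {h, g}" by blast
    qed
    then have "card (sep W x y) \<le> card (sep W x z \<union> sep W y z \<union> {h, g})"
      using fin by (intro card_mono) (auto simp: sep_def)
    also have "\<dots> \<le> card (sep W x z) + card (sep W y z) + card {h, g}"
      using card_Un_le[of "sep W x z \<union> sep W y z" "{h,g}"] card_Un_le[of "sep W x z" "sep W y z"] by linarith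
    also have "\<dots> \<le> (2 * r - 2) + (2 * r - 2) + 2"
      using z(3) z'(3) zz hg(3) by simp
    finally show False using far[OF xy] r(2) by linarith
  qed
  have "card S * r\<^sup>2 \<le> (\<Sum>x\<in>S. card (?V x))"
    using sum_bounded_below[of S "r\<^sup>2" "\<lambda>x. card (?V x)"] large by simp
  also have "\<dots> = card (\<Union>x\<in>S. ?V x)"
    using S(1) finV disj by (intro card_UN_disjoint[symmetric]) auto
  also have "\<dots> \<le> card (W \<times> W)" using fin sub by (intro card_mono) auto
  finally show ?thesis by (simp add: card_cartesian_product power2_eq_square)
qed

section \<open>Clusters that do not lie on a line\<close>

lemma det2_parallel:
  assumes "v \<noteq> 0" "det2 v z = 0"
  shows "\<exists>t. z = t *\<^sub>R v"
proof (rule orthogonal_parallel)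
  show "dir (hom v 0) \<noteq> 0" using assms(1) by (auto simp: dir_def hom_def nrm_def vec2_nonzero)
  show "dir (hom v 0) \<bullet> v = 0" "dir (hom v 0) \<bullet> z = 0"
    using assms(2) by (auto simp: dir_def hom_def nrm_def inner2 det2_def)
qed (use assms in auto)

text \<open>Order the points along their line. The number of lines that separate a point from the first one is
strictly increasing, as every line is crossed at most once and consecutive points are separated.\<close>

lemma card_collinear_points:
  assumes fin: "finite Y" "finite W" and x: "x \<in> Y"
    and coll: "\<And>y z. y \<in> Y \<Longrightarrow> z \<in> Y \<Longrightarrow> det2 (y - x) (z - x) = 0"
    and gen: "\<And>w y. w \<in> W \<Longrightarrow> y \<in> Y \<Longrightarrow> ev w y \<noteq> 0"
    and sep: "\<And>y z. y \<in> Y \<Longrightarrow> z \<in> Y \<Longrightarrow> y \<noteq> z \<Longrightarrow> sep W y z \<noteq> {}"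
    and close: "\<And>y z. y \<in> Y \<Longrightarrow> z \<in> Y \<Longrightarrow> card (sep W y z) \<le> D"
  shows "card Y \<le> D + 1"
proof (cases "Y = {x}")
  case True then show ?thesis by simp
next
  case False
  then obtain y1 where y1: "y1 \<in> Y" "y1 \<noteq> x" using x by blast
  define v where "v = y1 - x"
  have "\<forall>y. \<exists>t. y \<in> Y \<longrightarrow> y - x = t *\<^sub>R v"
    using det2_parallel[of v] coll y1 by (auto simp: v_def)
  then obtain t where t: "\<And>y. y \<in> Y \<Longrightarrow> y - x = t y *\<^sub>R v" by metis
  have Y: "y = x + t y *\<^sub>R v" if "y \<in> Y" for y using t[OF that] by (simp add: algebra_simps)
  obtain y0 where y0: "y0 \<in> Y" "\<And>y. y \<in> Y \<Longrightarrow> t y0 \<le> t y"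
    using ex_is_arg_min_if_finite[OF fin(1), of t] x unfolding is_arg_min_linorder by auto
  have mono: "card (sep W y0 y) < card (sep W y0 z)" if yz: "y \<in> Y" "z \<in> Y" "t y < t z" for y z
  proof (rule psubset_card_mono)
    define s where "s = (t y - t y0) / (t z - t y0)"
    have s: "0 \<le> s" "s \<le> 1" using y0(2)[OF yz(1)] yz(3) by (auto simp: s_def field_simps)
    have st: "s * (t z - t y0) = t y - t y0" using y0(2)[OF yz(1)] yz(3) by (simp add: s_def)
    have along: "b - y0 = (t b - t y0) *\<^sub>R v" if "b \<in> Y" for b
    proof -
      have "b - y0 = (b - x) - (y0 - x)" by simp
      then show ?thesis by (simp only: t[OF that] t[OF y0(1)] scaleR_left_diff_distrib)
    qed
    have "s *\<^sub>R (z - y0) = y - y0" unfolding along[OF yz(2)] along[OF yz(1)] by (simp add: st)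
    then have y: "y = y0 + s *\<^sub>R (z - y0)" by simp
    have sub: "w \<in> sep W y0 z" if w: "w \<in> sep W y0 y" for w
    proof (rule ccontr)
      assume "w \<notin> sep W y0 z"
      then have "ev w y0 * ev w z > 0" using w gen[of w] y0(1) yz(2) by (auto simp: sep_def not_less order_less_le)
      then have "ev w y * ev w y0 > 0" using same_side_segment[of w y0 z s] s y by simp
      then show False using w by (simp add: sep_def mult.commute)
    qed
    obtain u where u: "u \<in> sep W y z" using sep[OF yz(1,2)] yz(3) by blast
    have uW: "u \<in> W" "ev u y * ev u z < 0" using u by (auto simp: sep_def)
    have "u \<notin> sep W y0 y"
    proof
      assume "u \<in> sep W y0 y"
      then show False using sub[of u] uW by (auto simp: sep_def mult_less_0_iff)
    qed
    moreover from this have "u \<in> sep W y0 z"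
      using uW gen[of u y0] y0(1) by (auto simp: sep_def mult_less_0_iff)
    ultimately show "sep W y0 y \<subset> sep W y0 z" using sub by blast
    show "finite (sep W y0 z)" using fin(2) by (simp add: sep_def)
  qed
  have "card Y \<le> card {..D}"
  proof (rule card_inj_on_le[of "\<lambda>y. card (sep W y0 y)"])
    show "inj_on (\<lambda>y. card (sep W y0 y)) Y"
    proof (rule inj_onI)
      fix y z assume A: "y \<in> Y" "z \<in> Y" "card (sep W y0 y) = card (sep W y0 z)"
      then have "t y = t z" using mono[of y z] mono[of z y] by force
      then show "y = z" using Y[OF A(1)] Y[OF A(2)] by simp
    qed
  qed (use close[OF y0(1)] in auto)
  then show ?thesis by simp
qed

lemma maximal_separated_subset:
  assumes "finite Q"
  obtains S where "S \<subseteq> Q" "\<And>x y. x \<in> S \<Longrightarrow> y \<in> S \<Longrightarrow> x \<noteq> y \<Longrightarrow> k \<le> card (sep W x y)"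
    "\<And>y. y \<in> Q \<Longrightarrow> \<exists>x\<in>S. x = y \<or> card (sep W x y) < k"
proof -
  let ?A = "\<lambda>S. S \<subseteq> Q \<and> (\<forall>x\<in>S. \<forall>y\<in>S. x \<noteq> y \<longrightarrow> k \<le> card (sep W x y))"
  have comm: "sep W x y = sep W y x" for x y by (simp add: sep_def mult.commute)
  define F where "F = {S. ?A S}"
  have "finite F" by (rule finite_subset[of _ "Pow Q"]) (use assms in \<open>auto simp: F_def\<close>)
  moreover have "F \<noteq> {}" using empty_subsetI by (force simp: F_def)
  ultimately obtain S where SF: "S \<in> F" and max: "\<forall>S'\<in>F. S \<le> S' \<longrightarrow> S = S'"
    by (rule bexE[OF finite_has_maximal])
  from SF have S: "?A S" unfolding F_def by (rule CollectD)
  have "\<exists>x\<in>S. x = y \<or> card (sep W x y) < k" if y: "y \<in> Q" for y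
  proof (rule ccontr)
    assume no: "\<not> (\<exists>x\<in>S. x = y \<or> card (sep W x y) < k)"
    have "k \<le> card (sep W x y)" "k \<le> card (sep W y x)" if "x \<in> S" for x
    proof -
      have "\<not> card (sep W x y) < k" using no that by blast
      then show "k \<le> card (sep W x y)" by simp
      then show "k \<le> card (sep W y x)" by (simp only: comm[of y x])
    qed
    then have "?A (insert y S)" using S y by blast
    then have "insert y S \<in> F" unfolding F_def by (rule CollectI)
    then have "S = insert y S" using max subset_insertI by blast
    then show False using no by blast
  qed
  then show thesis using S by (intro that[of S]) auto
qed

text \<open>The balls of radius \<open>4 r\<close> around a maximal separated set cover \<open>Q\<close>. The balls contained in a
line have at most \<open>8 r\<close> points each, so by the packing bound they contain at most \<open>8 (card W)\<^sup>2 / r\<close>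
points together; each other ball has at most \<open>K\<close> points.\<close>

lemma many_noncollinear_clusters:
  assumes W: "transversal W" "no_three_concurrent W" and r: "0 < r" "r < card W"
    and Q: "finite Q" and gen: "\<And>w x. w \<in> W \<Longrightarrow> x \<in> Q \<Longrightarrow> ev w x \<noteq> 0"
    and sep: "\<And>x y. x \<in> Q \<Longrightarrow> y \<in> Q \<Longrightarrow> x \<noteq> y \<Longrightarrow> sep W x y \<noteq> {}"
    and small: "\<And>x. x \<in> Q \<Longrightarrow> card {y\<in>Q. card (sep W x y) < 4 * r} \<le> K"
  shows "card Q * r \<le> K * card {x\<in>Q. \<exists>y\<in>Q. \<exists>z\<in>Q. card (sep W x y) < 4 * r \<and> card (sep W x z) < 4 * r \<and>
      det2 (y - x) (z - x) \<noteq> 0} * r + 8 * (card W)\<^sup>2"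
proof -
  have fin: "finite W" using W by (simp add: transversal_def)
  let ?B = "\<lambda>x. {y\<in>Q. card (sep W x y) < 4 * r}"
  let ?N = "{x\<in>Q. \<exists>y\<in>Q. \<exists>z\<in>Q. card (sep W x y) < 4 * r \<and> card (sep W x z) < 4 * r \<and> det2 (y - x) (z - x) \<noteq> 0}"
  obtain S where S: "S \<subseteq> Q" "\<And>x y. x \<in> S \<Longrightarrow> y \<in> S \<Longrightarrow> x \<noteq> y \<Longrightarrow> 4 * r \<le> card (sep W x y)"
    "\<And>y. y \<in> Q \<Longrightarrow> \<exists>x\<in>S. x = y \<or> card (sep W x y) < 4 * r"
    by (rule maximal_separated_subset[OF Q, of "4 * r" W]) blast
  have finS: "finite S" using S(1) Q finite_subset by blast
  have self: "x \<in> ?B x" if "x \<in> Q" for x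
  proof -
    have "sep W x x = {}" by (auto simp: sep_def mult_less_0_iff)
    then show ?thesis using that r by simp
  qed
  have cover: "Q \<subseteq> (\<Union>x\<in>S. ?B x)" using S(1,3) self by blast
  have thin: "card (?B x) \<le> 8 * r" if x: "x \<in> S - ?N" for x
  proof -
    have "card (?B x) \<le> (8 * r - 2) + 1"
    proof (rule card_collinear_points[of _ W x])
      have xQ: "x \<in> Q" using x S(1) by blast
      show "x \<in> ?B x" by (rule self[OF xQ])
      show "det2 (y - x) (z - x) = 0" if "y \<in> ?B x" "z \<in> ?B x" for y z using x xQ that by blast
      show "card (sep W y z) \<le> 8 * r - 2" if yz: "y \<in> ?B x" "z \<in> ?B x" for y z
      proof -
        have "sep W y z \<subseteq> sep W x y \<union> sep W x z"
        proof
          fix w assume "w \<in> sep W y z"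
          then have "w \<in> W" "ev w y * ev w z < 0" "ev w x \<noteq> 0" using gen xQ by (auto simp: sep_def)
          then show "w \<in> sep W x y \<union> sep W x z" by (auto simp: sep_def mult_less_0_iff)
        qed
        then have "card (sep W y z) \<le> card (sep W x y \<union> sep W x z)"
          using fin by (intro card_mono) (auto simp: sep_def)
        also have "\<dots> \<le> card (sep W x y) + card (sep W x z)" by (rule card_Un_le)
        finally have "card (sep W y z) \<le> card (sep W x y) + card (sep W x z)" .
        moreover have "card (sep W x y) < 4 * r" "card (sep W x z) < 4 * r" using yz by blast+
        ultimately show ?thesis by linarith
      qed
    qed (use Q fin gen sep in auto)
    then show ?thesis using r by simp
  qed
  have "card Q \<le> card (\<Union>x\<in>S. ?B x)" using cover finS Q by (intro card_mono) auto
  also have "\<dots> \<le> (\<Sum>x\<in>S. card (?B x))" by (rule card_UN_le[OF finS])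
  also have "\<dots> = (\<Sum>x\<in>S \<inter> ?N. card (?B x)) + (\<Sum>x\<in>S - ?N. card (?B x))"
    by (rule sum.Int_Diff[OF finS])
  also have "\<dots> \<le> card (S \<inter> ?N) * K + card (S - ?N) * (8 * r)"
  proof (rule add_mono)
    show "(\<Sum>x\<in>S \<inter> ?N. card (?B x)) \<le> card (S \<inter> ?N) * K"
      using sum_bounded_above[of "S \<inter> ?N" "\<lambda>x. card (?B x)" K] small by simp
    show "(\<Sum>x\<in>S - ?N. card (?B x)) \<le> card (S - ?N) * (8 * r)"
      using sum_bounded_above[of "S - ?N" "\<lambda>x. card (?B x)" "8 * r"] thin by simp
  qed
  also have "\<dots> \<le> card ?N * K + card S * (8 * r)"
    using Q finS by (intro add_mono mult_le_mono1 card_mono) auto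
  finally have "card Q * r \<le> (card ?N * K + card S * (8 * r)) * r" by (rule mult_le_mono1)
  also have "\<dots> = K * card ?N * r + 8 * (card S * r\<^sup>2)"
    by (simp add: algebra_simps power2_eq_square)
  also have "card S * r\<^sup>2 \<le> (card W)\<^sup>2"
    by (rule packing[OF W r(2,1) finS]) (use gen S in auto)
  finally show ?thesis by simp
qed

section \<open>Affine maps and point triples\<close>

text \<open>Preimages of lines under an affine map are lines.\<close>

lemma affine_pullback:
  assumes "affine_map \<phi>"
  shows "\<exists>w'. \<forall>v. ev w' v = ev w (\<phi> v)"
proof -
  obtain a1 b1 c1 a2 b2 c2 where
    "\<forall>v. \<phi> v = vector [a1 * v$1 + b1 * v$2 + c1, a2 * v$1 + b2 * v$2 + c2]"
    using assms unfolding affine_map_def by blast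
  then have "ev (vector [w$1 * a1 + w$2 * a2, w$1 * b1 + w$2 * b2, w$1 * c1 + w$2 * c2 + w$3]) v = ev w (\<phi> v)" for v
    by (simp add: ev_def inner2 nrm_def algebra_simps)
  then show ?thesis by blast
qed

lemma ev_diff: "ev (v - w) x = ev v x - ev w x"
  by (simp add: ev_eq_inner inner_diff_left)

lemma form_zero:
  assumes "ev w x = 0" "ev w y = 0" "ev w z = 0" "det2 (y - x) (z - x) \<noteq> 0"
  shows "ev w v = 0"
proof -
  have "nrm w \<bullet> (y - x) = 0" "nrm w \<bullet> (z - x) = 0" using assms by (simp_all add: ev_def inner_diff_right)
  then have "nrm w $ 1 * det2 (y - x) (z - x) = 0" "nrm w $ 2 * det2 (y - x) (z - x) = 0"
    unfolding inner2 det2_def by algebra+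
  then have "nrm w = 0" using assms(4) by (simp add: vec_eq_iff forall_2)
  then show ?thesis using assms(1) by (simp add: ev_def)
qed

lemma affine_maps_agree:
  assumes "affine_map \<phi>" "affine_map \<psi>" "det2 (y - x) (z - x) \<noteq> 0"
    "\<phi> x = \<psi> x" "\<phi> y = \<psi> y" "\<phi> z = \<psi> z"
  shows "\<phi> = \<psi>"
proof
  fix v
  have "ev k (\<phi> v) = ev k (\<psi> v)" for k
  proof -
    obtain f g where fg: "\<And>v. ev f v = ev k (\<phi> v)" "\<And>v. ev g v = ev k (\<psi> v)"
      using affine_pullback[OF assms(1)] affine_pullback[OF assms(2)] by metis
    have "ev (f - g) v = 0" by (rule form_zero[OF _ _ _ assms(3)]) (simp_all add: ev_diff fg assms(4-6))
    then show ?thesis by (simp add: ev_diff fg)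
  qed
  from this[of "vector [1, 0, 0]"] this[of "vector [0, 1, 0]"]
  show "\<phi> v = \<psi> v" by (simp add: ev_def inner2 nrm_def vec_eq_iff forall_2)
qed

lemma affine_map_inj:
  assumes "affine_map \<phi>"
  shows "inj \<phi>"
proof (rule injI)
  fix x y assume eq: "\<phi> x = \<phi> y"
  obtain a1 b1 c1 a2 b2 c2 where d: "a1 * b2 - a2 * b1 \<noteq> 0" and
    \<phi>: "\<And>v. \<phi> v = vector [a1 * v$1 + b1 * v$2 + c1, a2 * v$1 + b2 * v$2 + c2]"
    using assms unfolding affine_map_def by blast
  have "\<phi> x $ 1 = \<phi> y $ 1" "\<phi> x $ 2 = \<phi> y $ 2" using eq by auto
  then have "a1 * (x$1 - y$1) + b1 * (x$2 - y$2) = 0" "a2 * (x$1 - y$1) + b2 * (x$2 - y$2) = 0"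
    unfolding \<phi> by (simp_all add: algebra_simps)
  then have "(a1 * b2 - a2 * b1) * (x$1 - y$1) = 0" "(a1 * b2 - a2 * b1) * (x$2 - y$2) = 0"
    by algebra+
  then show "x = y" using d by (simp add: vec_eq_iff forall_2)
qed

text \<open>The inner map moves points along the normal of \<open>w\<close> in proportion to \<open>ev w\<close>, so it fixes the line
of \<open>w\<close> pointwise. Its determinant is \<open>1 + s (w\<^sub>1\<^sup>2 + w\<^sub>2\<^sup>2)\<close>, which is positive.\<close>

lemma affine_map_shear:
  assumes "affine_map \<phi>" "s \<ge> 0"
  shows "affine_map (\<lambda>v. \<phi> (v + (s * ev w v) *\<^sub>R nrm w))"
proof -
  obtain a1 b1 c1 a2 b2 c2 where d: "a1 * b2 - a2 * b1 \<noteq> 0" and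
    \<phi>: "\<And>v. \<phi> v = vector [a1 * v$1 + b1 * v$2 + c1, a2 * v$1 + b2 * v$2 + c2]"
    using assms unfolding affine_map_def by blast
  let ?u = "w$1" and ?v = "w$2" and ?c = "w$3"
  let ?A = "\<lambda>a b. a * (1 + s * ?u\<^sup>2) + b * s * ?u * ?v"
  let ?B = "\<lambda>a b. a * s * ?u * ?v + b * (1 + s * ?v\<^sup>2)"
  let ?C = "\<lambda>a b c. c + s * ?c * (a * ?u + b * ?v)"
  have "?A a1 b1 * ?B a2 b2 - ?A a2 b2 * ?B a1 b1 = (a1 * b2 - a2 * b1) * (1 + s * (?u\<^sup>2 + ?v\<^sup>2))"
    by (simp add: algebra_simps power2_eq_square)
  moreover have "1 + s * (?u\<^sup>2 + ?v\<^sup>2) > 0" using assms(2) by (intro add_pos_nonneg mult_nonneg_nonneg) auto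
  ultimately have "?A a1 b1 * ?B a2 b2 - ?A a2 b2 * ?B a1 b1 \<noteq> 0" using d by simp
  moreover have "\<phi> (v + (s * ev w v) *\<^sub>R nrm w) =
    vector [?A a1 b1 * v$1 + ?B a1 b1 * v$2 + ?C a1 b1 c1, ?A a2 b2 * v$1 + ?B a2 b2 * v$2 + ?C a2 b2 c2]" for v
    unfolding \<phi> by (simp add: ev_def inner2 nrm_def algebra_simps power2_eq_square vec_eq_iff forall_2)
  ultimately show ?thesis unfolding affine_map_def by blast
qed

lemma line_through_collinear:
  assumes "\<And>x y z. x \<in> Q \<Longrightarrow> y \<in> Q \<Longrightarrow> z \<in> Q \<Longrightarrow> det2 (y - x) (z - x) = 0"
  shows "\<exists>w. nrm w \<noteq> 0 \<and> (\<forall>x\<in>Q. ev w x = 0)"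
proof (cases "\<exists>x y. x \<in> Q \<and> y \<in> Q \<and> x \<noteq> y")
  case True
  then obtain x y where xy: "x \<in> Q" "y \<in> Q" "x \<noteq> y" by blast
  define w :: form where "w = vector [- (y - x)$2, (y - x)$1, (y - x)$2 * x$1 - (y - x)$1 * x$2]"
  have "ev w z = det2 (y - x) (z - x)" for z
    by (simp add: w_def ev_def inner2 nrm_def det2_def algebra_simps)
  moreover have "nrm w \<noteq> 0" using xy(3) by (auto simp: w_def nrm_def vec2_nonzero vec_eq_iff forall_2)
  ultimately show ?thesis using assms xy by metis
next
  case False
  then obtain p where p: "\<forall>x\<in>Q. x = p" by metis
  define w :: form where "w = vector [1, 0, - p$1]"
  have "ev w p = 0" "nrm w \<noteq> 0" by (simp_all add: w_def ev_def inner2 nrm_def vec2_nonzero)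
  then show ?thesis using p by metis
qed

text \<open>Precomposing \<open>\<phi>\<close> with the maps that fix the line pointwise and stretch its normal
direction does not change the images of the points that \<open>\<phi>\<close> keeps in \<open>P\<close>.\<close>

lemma infinitely_many_rich:
  assumes "\<phi> \<in> rich_affine_maps c P" "finite P"
    and coll: "\<And>x y z. x \<in> {x\<in>P. \<phi> x \<in> P} \<Longrightarrow> y \<in> {x\<in>P. \<phi> x \<in> P} \<Longrightarrow> z \<in> {x\<in>P. \<phi> x \<in> P} \<Longrightarrow> det2 (y - x) (z - x) = 0"
  shows "infinite (rich_affine_maps c P)"
proof -
  have \<phi>: "affine_map \<phi>" "real (card (\<phi> ` P \<inter> P)) \<ge> c * real (card P)"
    using assms(1) by (auto simp: rich_affine_maps_def)
  obtain w where w: "nrm w \<noteq> 0" "\<forall>x\<in>{x\<in>P. \<phi> x \<in> P}. ev w x = 0"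
    using line_through_collinear[OF coll] by blast
  define \<psi> where "\<psi> = (\<lambda>s v. \<phi> (v + (s * ev w v) *\<^sub>R nrm w))"
  have sub: "\<psi> s \<in> rich_affine_maps c P" if "s > 0" for s
  proof -
    have "\<phi> ` P \<inter> P \<subseteq> \<psi> s ` P \<inter> P"
    proof
      fix y assume y: "y \<in> \<phi> ` P \<inter> P"
      then obtain x where x: "x \<in> P" "y = \<phi> x" by blast
      then have "ev w x = 0" using w(2) y by blast
      then have "\<psi> s x = y" using x by (simp add: \<psi>_def)
      then show "y \<in> \<psi> s ` P \<inter> P" using x y by blast
    qed
    then have "card (\<phi> ` P \<inter> P) \<le> card (\<psi> s ` P \<inter> P)" using assms(2) by (intro card_mono) auto
    moreover have "affine_map (\<psi> s)" unfolding \<psi>_def using that by (intro affine_map_shear[OF \<phi>(1)]) simp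
    ultimately show ?thesis using \<phi>(2) by (simp add: rich_affine_maps_def)
  qed
  have inj: "inj_on \<psi> {0<..}"
  proof (rule inj_onI)
    fix s t assume "\<psi> s = \<psi> t"
    obtain p where p: "ev w p = 0" using ex_zero[OF w(1)] by blast
    define v where "v = p + 1 *\<^sub>R nrm w"
    have v: "ev w v \<noteq> 0" unfolding v_def ev_move using p w(1) by simp
    have "\<psi> s v = \<psi> t v" using \<open>\<psi> s = \<psi> t\<close> by simp
    then have "v + (s * ev w v) *\<^sub>R nrm w = v + (t * ev w v) *\<^sub>R nrm w"
      unfolding \<psi>_def by (rule injD[OF affine_map_inj[OF \<phi>(1)]])
    then show "s = t" using v w(1) by simp
  qed
  have "infinite (\<psi> ` {0<..})" using finite_imageD[OF _ inj] infinite_Ioi by blast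
  then show ?thesis using sub finite_subset[of "\<psi> ` {0<..}"] by blast
qed

text \<open>A pair of triples \<open>(t, \<phi> t)\<close> with \<open>t\<close> not collinear determines \<open>\<phi>\<close>, so different maps use
disjoint parts of \<open>T \<times> T\<close>.\<close>

lemma count_maps_by_triples:
  fixes s :: real
  assumes T: "finite T" and s: "s > 0"
    and F: "\<And>\<phi>. \<phi> \<in> F \<Longrightarrow> affine_map \<phi>"
    and X: "\<And>\<phi>. \<phi> \<in> F \<Longrightarrow> s \<le> real (card {(x, y, z). (x, y, z) \<in> T \<and> (\<phi> x, \<phi> y, \<phi> z) \<in> T \<and> det2 (y - x) (z - x) \<noteq> 0})"
  shows "finite F \<and> real (card F) * s \<le> (real (card T))\<^sup>2"
proof -
  define E where "E = (\<lambda>\<phi>. (\<lambda>(x, y, z). ((x, y, z), (\<phi> x, \<phi> y, \<phi> z))) `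
    {(x, y, z). (x, y, z) \<in> T \<and> (\<phi> x, \<phi> y, \<phi> z) \<in> T \<and> det2 (y - x) (z - x) \<noteq> 0})"
  have sub: "E \<phi> \<subseteq> T \<times> T" for \<phi> by (auto simp: E_def)
  have finE: "finite (E \<phi>)" for \<phi> using finite_subset[OF sub] T by blast
  have cardE: "s \<le> real (card (E \<phi>))" if "\<phi> \<in> F" for \<phi>
  proof -
    have "card (E \<phi>) = card {(x, y, z). (x, y, z) \<in> T \<and> (\<phi> x, \<phi> y, \<phi> z) \<in> T \<and> det2 (y - x) (z - x) \<noteq> 0}"
      unfolding E_def by (rule card_image) (auto simp: inj_on_def)
    then show ?thesis using X[OF that] by simp
  qed
  have disj: "E \<phi> \<inter> E \<psi> = {}" if "\<phi> \<in> F" "\<psi> \<in> F" "\<phi> \<noteq> \<psi>" for \<phi> \<psi>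
  proof (rule ccontr)
    assume "E \<phi> \<inter> E \<psi> \<noteq> {}"
    then obtain x y z where "det2 (y - x) (z - x) \<noteq> 0" "\<phi> x = \<psi> x" "\<phi> y = \<psi> y" "\<phi> z = \<psi> z"
      unfolding E_def by auto
    then show False using affine_maps_agree[of \<phi> \<psi>] F that by blast
  qed
  have bound: "real (card G) * s \<le> (real (card T))\<^sup>2" if G: "G \<subseteq> F" "finite G" for G
  proof -
    have "real (card G) * s \<le> (\<Sum>\<phi>\<in>G. real (card (E \<phi>)))"
      using sum_bounded_below[of G s "\<lambda>\<phi>. real (card (E \<phi>))"] cardE G by auto
    also have "\<dots> = real (card (\<Union>\<phi>\<in>G. E \<phi>))"
      using disj G finE by (subst card_UN_disjoint) auto
    also have "card (\<Union>\<phi>\<in>G. E \<phi>) \<le> card (T \<times> T)" using sub T by (intro card_mono) auto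
    finally show ?thesis by (simp add: card_cartesian_product power2_eq_square)
  qed
  have "finite F"
  proof (rule ccontr)
    assume "infinite F"
    obtain n :: nat where n: "(real (card T))\<^sup>2 / s < real n" using reals_Archimedean2 by blast
    obtain G where G: "G \<subseteq> F" "finite G" "card G = n"
      using infinite_arbitrarily_large[OF \<open>infinite F\<close>] by blast
    then show False using bound[OF G(1,2)] n s by (simp add: field_simps)
  qed
  then show ?thesis using bound by blast
qed

section \<open>Close triples preserved by an affine map\<close>

lemma sep_perturbed:
  assumes "\<And>i. i \<in> I \<Longrightarrow> ev (g i) x * ev (f i) x > 0 \<and> ev (g i) y * ev (f i) y > 0"
  shows "sep (g ` I) x y = g ` {i\<in>I. ev (f i) x * ev (f i) y < 0}"
proof -
  have "ev (g i) x * ev (g i) y < 0 \<longleftrightarrow> ev (f i) x * ev (f i) y < 0" if "i \<in> I" for i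
    using assms[OF that] by (auto simp: mult_less_0_iff zero_less_mult_iff)
  then show ?thesis by (auto simp: sep_def)
qed

definition crowded :: "form set \<Rightarrow> (real^2) set \<Rightarrow> nat \<Rightarrow> nat \<Rightarrow> (real^2) set" where
  "crowded G P k K = {x\<in>P. card {y\<in>P. card (sep G x y) < k} > K}"

text \<open>The number of separating lines depends only on the signs at the points of \<open>P\<close>, so the lines may be
perturbed first.\<close>

lemma few_crowded_points:
  fixes \<delta> :: real
  assumes "\<delta> > 0"
  obtains K :: nat where "\<And>G P. finite G \<Longrightarrow> finite P \<Longrightarrow> (\<And>w x. w \<in> G \<Longrightarrow> x \<in> P \<Longrightarrow> ev w x \<noteq> 0) \<Longrightarrow>
    (\<And>x y. x \<in> P \<Longrightarrow> y \<in> P \<Longrightarrow> x \<noteq> y \<Longrightarrow> sep G x y \<noteq> {}) \<Longrightarrow>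
    real (card (crowded G P (Suc k) K)) \<le> \<delta> * (real (card G))\<^sup>2"
proof -
  from few_crowded_points_general_position[OF assms, of k] obtain K :: nat where
    K: "\<And>W P. transversal W \<Longrightarrow> crossed_separately W P \<Longrightarrow> finite P \<Longrightarrow> (\<forall>w\<in>W. \<forall>x\<in>P. ev w x \<noteq> 0) \<Longrightarrow>
    (\<forall>x\<in>P. \<forall>y\<in>P. x \<noteq> y \<longrightarrow> sep W x y \<noteq> {}) \<Longrightarrow>
    real (card {x\<in>P. card {y\<in>P. card (sep W x y) \<le> k} > K}) \<le> \<delta> * (real (card W))\<^sup>2"
    by blast
  show thesis
  proof (rule that[of K])
    fix G :: "form set" and P :: "(real^2) set"
    assume G: "finite G" and P: "finite P" and gen: "\<And>w x. w \<in> G \<Longrightarrow> x \<in> P \<Longrightarrow> ev w x \<noteq> 0"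
      and sep: "\<And>x y. x \<in> P \<Longrightarrow> y \<in> P \<Longrightarrow> x \<noteq> y \<Longrightarrow> sep G x y \<noteq> {}"
    obtain g where g: "inj_on g G" "\<forall>i\<in>G. \<forall>x\<in>P. ev (g i) x * ev i x > 0"
      "transversal (g ` G)" "crossed_separately (g ` G) P"
      using perturb_to_general_position[of G P "\<lambda>i. i"] G P gen by blast
    have eq: "sep (g ` G) x y = g ` sep G x y" if "x \<in> P" "y \<in> P" for x y
      unfolding sep_def[of G] using g(2) that by (intro sep_perturbed) blast
    have card_eq: "card (sep (g ` G) x y) = card (sep G x y)" if "x \<in> P" "y \<in> P" for x y
      unfolding eq[OF that] by (rule card_image, rule inj_on_subset[OF g(1)]) (auto simp: sep_def)
    have "real (card {x\<in>P. card {y\<in>P. card (sep (g ` G) x y) \<le> k} > K}) \<le> \<delta> * (real (card (g ` G)))\<^sup>2"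
    proof (rule K[OF g(3,4) P])
      show "\<forall>w\<in>g ` G. \<forall>x\<in>P. ev w x \<noteq> 0"
      proof clarify
        fix i x assume "i \<in> G" "x \<in> P" "ev (g i) x = 0"
        then show False using g(2) by (metis less_irrefl mult_zero_left)
      qed
      show "\<forall>x\<in>P. \<forall>y\<in>P. x \<noteq> y \<longrightarrow> sep (g ` G) x y \<noteq> {}" using eq sep by simp
    qed
    moreover have "{x\<in>P. card {y\<in>P. card (sep (g ` G) x y) \<le> k} > K} = crowded G P (Suc k) K"
    proof -
      have "{y\<in>P. card (sep (g ` G) x y) \<le> k} = {y\<in>P. card (sep G x y) < Suc k}" if "x \<in> P" for x
        using card_eq[OF that] by auto
      then show ?thesis unfolding crowded_def by (metis (mono_tags, lifting))
    qed
    ultimately show "real (card (crowded G P (Suc k) K)) \<le> \<delta> * (real (card G))\<^sup>2"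
      using card_image[OF g(1)] by simp
  qed
qed

text \<open>The clusters are taken with respect to the lines of \<open>G\<close> and their preimages under \<open>\<phi>\<close>, perturbed
together. Lines of \<open>G\<close> separating \<open>x\<close> and \<open>y\<close>, and lines of \<open>G\<close> separating \<open>\<phi> x\<close> and \<open>\<phi> y\<close>,
both count as lines of this family separating \<open>x\<close> and \<open>y\<close>.\<close>

lemma many_close_triples:
  assumes G: "finite G" and P: "finite P" and gen: "\<And>w x. w \<in> G \<Longrightarrow> x \<in> P \<Longrightarrow> ev w x \<noteq> 0"
    and sep: "\<And>x y. x \<in> P \<Longrightarrow> y \<in> P \<Longrightarrow> x \<noteq> y \<Longrightarrow> sep G x y \<noteq> {}"
    and \<phi>: "affine_map \<phi>" and r: "0 < r" "r < 2 * card G"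
    and Q: "Q \<subseteq> P" "\<phi> ` Q \<subseteq> P" "Q \<inter> crowded G P (4 * r) K = {}"
  shows "card Q * r \<le> K * card {x\<in>Q. \<exists>y\<in>Q. \<exists>z\<in>Q. det2 (y - x) (z - x) \<noteq> 0 \<and>
      card (sep G x y) < 4 * r \<and> card (sep G x z) < 4 * r \<and>
      card (sep G (\<phi> x) (\<phi> y)) < 4 * r \<and> card (sep G (\<phi> x) (\<phi> z)) < 4 * r} * r + 32 * (card G)\<^sup>2"
proof -
  have "\<forall>w. \<exists>w'. \<forall>v. ev w' v = ev w (\<phi> v)" using affine_pullback[OF \<phi>] by blast
  then obtain pull where pull: "\<And>w v. ev (pull w) v = ev w (\<phi> v)" by metis
  \<comment> \<open>The index \<open>(w, False)\<close> stands for the line itself and \<open>(w,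
    True)\<close> for its preimage. An index set is used because the two families may overlap before the
    perturbation.\<close>
  define I where "I = G \<times> (UNIV :: bool set)"
  define f where "f = (\<lambda>(w, b). if b then pull w else w)"
  have finI: "finite I" "card I = 2 * card G" using G by (simp_all add: I_def card_cartesian_product)
  have finQ: "finite Q" using Q(1) P finite_subset by blast
  have genQ: "ev (f i) x \<noteq> 0" if ix: "i \<in> I" "x \<in> Q" for i x
  proof -
    obtain w b where i: "i = (w, b)" "w \<in> G" using ix(1) unfolding I_def by blast
    have "x \<in> P" "\<phi> x \<in> P" using ix(2) Q(1,2) by auto
    then show ?thesis using gen[OF i(2)] unfolding i(1) f_def by (simp add: pull)
  qed
  obtain g where g: "inj_on g I" "\<forall>i\<in>I. \<forall>x\<in>Q. ev (g i) x * ev (f i) x > 0"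
      "transversal (g ` I)" "no_three_concurrent (g ` I)"
    using perturb_to_general_position[OF finI(1) finQ, of f] genQ by blast
  let ?W = "g ` I"
  have cW: "card ?W = 2 * card G" using card_image[OF g(1)] finI by simp
  have eq: "sep ?W x y = g ` {i\<in>I. ev (f i) x * ev (f i) y < 0}" if "x \<in> Q" "y \<in> Q" for x y
    using g(2) that by (intro sep_perturbed) blast
  have finsep: "finite (sep ?W x y)" for x y using finI by (simp add: sep_def)
  have le1: "card (sep G x y) \<le> card (sep ?W x y)" if "x \<in> Q" "y \<in> Q" for x y
  proof (rule card_inj_on_le[of "\<lambda>w. g (w, False)"])
    show "inj_on (\<lambda>w. g (w, False)) (sep G x y)"
      using inj_onD[OF g(1)] by (intro inj_onI) (auto simp: I_def sep_def)
    show "(\<lambda>w. g (w, False)) ` sep G x y \<subseteq> sep ?W x y"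
      unfolding eq[OF that] by (auto simp: I_def f_def sep_def)
  qed (rule finsep)
  have le2: "card (sep G (\<phi> x) (\<phi> y)) \<le> card (sep ?W x y)" if "x \<in> Q" "y \<in> Q" for x y
  proof (rule card_inj_on_le[of "\<lambda>w. g (w, True)"])
    show "inj_on (\<lambda>w. g (w, True)) (sep G (\<phi> x) (\<phi> y))"
      using inj_onD[OF g(1)] by (intro inj_onI) (auto simp: I_def sep_def)
    show "(\<lambda>w. g (w, True)) ` sep G (\<phi> x) (\<phi> y) \<subseteq> sep ?W x y"
      unfolding eq[OF that] by (auto simp: I_def f_def sep_def pull)
  qed (rule finsep)
  let ?N = "{x\<in>Q. \<exists>y\<in>Q. \<exists>z\<in>Q. card (sep ?W x y) < 4 * r \<and> card (sep ?W x z) < 4 * r \<and> det2 (y - x) (z - x) \<noteq> 0}"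
  let ?M = "{x\<in>Q. \<exists>y\<in>Q. \<exists>z\<in>Q. det2 (y - x) (z - x) \<noteq> 0 \<and>
      card (sep G x y) < 4 * r \<and> card (sep G x z) < 4 * r \<and>
      card (sep G (\<phi> x) (\<phi> y)) < 4 * r \<and> card (sep G (\<phi> x) (\<phi> z)) < 4 * r}"
  have "card Q * r \<le> K * card ?N * r + 8 * (card ?W)\<^sup>2"
  proof (rule many_noncollinear_clusters[OF g(3,4) r(1) _ finQ])
    show "r < card ?W" using r(2) cW by simp
    show "ev w x \<noteq> 0" if "w \<in> ?W" "x \<in> Q" for w x
    proof -
      obtain i where "i \<in> I" "w = g i" using \<open>w \<in> ?W\<close> by blast
      then show ?thesis using g(2) \<open>x \<in> Q\<close> by (metis less_irrefl mult_zero_left)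
    qed
    show "sep ?W x y \<noteq> {}" if xy: "x \<in> Q" "y \<in> Q" "x \<noteq> y" for x y
    proof -
      have "sep G x y \<noteq> {}" using sep xy Q(1) by blast
      moreover have "finite (sep G x y)" using G by (simp add: sep_def)
      ultimately have "card (sep G x y) > 0" by (simp add: card_gt_0_iff)
      then show ?thesis using le1[OF xy(1,2)] by auto
    qed
    show "card {y\<in>Q. card (sep ?W x y) < 4 * r} \<le> K" if x: "x \<in> Q" for x
    proof -
      have "{y\<in>Q. card (sep ?W x y) < 4 * r} \<subseteq> {y\<in>P. card (sep G x y) < 4 * r}"
        using le1[OF x] Q(1) by (auto intro: le_less_trans)
      then have "card {y\<in>Q. card (sep ?W x y) < 4 * r} \<le> card {y\<in>P. card (sep G x y) < 4 * r}"
        using P by (intro card_mono) auto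
      also have "\<dots> \<le> K" using Q(1,3) x unfolding crowded_def by force
      finally show ?thesis .
    qed
  qed
  moreover have "card ?N \<le> card ?M"
  proof (rule card_mono)
    show "finite ?M" using finQ by simp
    show "?N \<subseteq> ?M"
    proof
      fix x assume "x \<in> ?N"
      then obtain y z where x: "x \<in> Q" and yz: "y \<in> Q" "z \<in> Q" "card (sep ?W x y) < 4 * r" "card (sep ?W x z) < 4 * r"
        "det2 (y - x) (z - x) \<noteq> 0" by blast
      then show "x \<in> ?M" using le1[OF x yz(1)] le1[OF x yz(2)] le2[OF x yz(1)] le2[OF x yz(2)]
        by (intro CollectI conjI bexI[of _ y] bexI[of _ z]) simp_all
    qed
  qed
  then have "K * card ?N * r \<le> K * card ?M * r" by (intro mult_le_mono order_refl)
  moreover have "8 * (card ?W)\<^sup>2 = 32 * (card G)\<^sup>2" unfolding cW by (simp add: power_mult_distrib)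
  ultimately show ?thesis by linarith
qed

text \<open>If no line of \<open>H\<close> separates two points, then the segment between them is a connected set that avoids
all lines, and the points lie in the same component.\<close>

lemma separating_forms:
  assumes "proper_dimensional C (P :: (real^2) set)"
  obtains G where "finite G" "real (card G) \<le> C * sqrt (real (card P))"
    "\<And>w x. w \<in> G \<Longrightarrow> x \<in> P \<Longrightarrow> ev w x \<noteq> 0"
    "\<And>x y. x \<in> P \<Longrightarrow> y \<in> P \<Longrightarrow> x \<noteq> y \<Longrightarrow> sep G x y \<noteq> {}"
proof -
  obtain H where H: "finite H" "\<forall>h\<in>H. hyperplane h"
    "real (card H) \<le> C * real (card P) powr (1 / real DIM(real^2))"
    "cuts_into_singletons H P"
    using assms unfolding proper_dimensional_def by blast
  have "\<exists>w. h = {x. ev w x = 0}" if h: "h \<in> H" for h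
  proof -
    obtain a b where ab: "h = {x. a \<bullet> x = b}" using H(2) h unfolding hyperplane_def by blast
    have "ev (hom a (- b)) x = a \<bullet> x - b" for x
      by (simp add: ev_def hom_def nrm_def inner2)
    then show ?thesis using ab by (intro exI[of _ "hom a (- b)"]) auto
  qed
  then obtain fm where fm: "\<And>h. h \<in> H \<Longrightarrow> h = {x. ev (fm h) x = 0}" by metis
  have out: "x \<notin> \<Union>H" if "x \<in> P" for x using H(4) that unfolding cuts_into_singletons_def by blast
  show thesis
  proof (rule that[of "fm ` H"])
    show "finite (fm ` H)" using H(1) by simp
    have "real (card (fm ` H)) \<le> real (card H)" using card_image_le[OF H(1)] by simp
    also have "\<dots> \<le> C * sqrt (real (card P))" using H(3) by (simp add: powr_half_sqrt)
    finally show "real (card (fm ` H)) \<le> C * sqrt (real (card P))" .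
    show gen: "ev w x \<noteq> 0" if wx: "w \<in> fm ` H" "x \<in> P" for w x
    proof -
      obtain h where h: "h \<in> H" "w = fm h" using wx(1) by blast
      have "x \<notin> h" using out[OF wx(2)] h(1) by blast
      then show ?thesis using fm[OF h(1)] h(2) by blast
    qed
    show "sep (fm ` H) x y \<noteq> {}" if xy: "x \<in> P" "y \<in> P" "x \<noteq> y" for x y
    proof
      assume none: "sep (fm ` H) x y = {}"
      have "closed_segment x y \<subseteq> - \<Union>H"
      proof
        fix z assume "z \<in> closed_segment x y"
        then obtain u where u: "0 \<le> u" "u \<le> 1" "z = x + u *\<^sub>R (y - x)"
          unfolding closed_segment_def by (auto simp: algebra_simps)
        have "z \<notin> h" if h: "h \<in> H" for h
        proof -
          have "ev (fm h) x * ev (fm h) y > 0"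
          proof -
            have "\<not> ev (fm h) x * ev (fm h) y < 0" using none h unfolding sep_def by blast
            moreover have "ev (fm h) x * ev (fm h) y \<noteq> 0" using gen[of "fm h"] h xy by simp
            ultimately show ?thesis by linarith
          qed
          then have "ev (fm h) z \<noteq> 0" using same_side_segment[of "fm h" x y u] u by force
          then show ?thesis using fm[OF h] by blast
        qed
        then show "z \<in> - \<Union>H" by blast
      qed
      then have "connected_component (- \<Union>H) x y"
        unfolding connected_component_def by (intro exI[of _ "closed_segment x y"]) auto
      then have "connected_component_set (- \<Union>H) x = connected_component_set (- \<Union>H) y"
        by (simp add: connected_component_eq)
      then show False using H(4) xy unfolding cuts_into_singletons_def by (meson inj_onD)
    qed
  qed
qed

section \<open>The bound on rich affine maps\<close>

lemma card_points_le_pow_lines: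
  assumes "finite G" "finite P" "\<And>w x. w \<in> G \<Longrightarrow> x \<in> P \<Longrightarrow> ev w x \<noteq> 0"
    "\<And>x y. x \<in> P \<Longrightarrow> y \<in> P \<Longrightarrow> x \<noteq> y \<Longrightarrow> sep G x y \<noteq> {}"
  shows "card P \<le> 2 ^ card G"
proof -
  have "card P \<le> card (Pow G)"
  proof (rule card_inj_on_le[of "pos G"])
    show "inj_on (pos G) P" by (rule inj_on_pos) (use assms in auto)
    show "pos G ` P \<subseteq> Pow G" by (auto simp: pos_def)
  qed (use assms in simp)
  then show ?thesis using assms(1) by (simp add: card_Pow)
qed

text \<open>Since there are only finitely many rich maps, each of them keeps a non-collinear triple of points
in \<open>P\<close>; all triples of points of \<open>P\<close> are used for counting.\<close>

lemma card_rich_affine_maps_le_pow6: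
  assumes P: "finite P" and F: "finite (rich_affine_maps c P)"
  shows "real (card (rich_affine_maps c P)) \<le> real (card P) ^ 6"
proof -
  let ?T = "P \<times> P \<times> P"
  have "finite (rich_affine_maps c P) \<and> real (card (rich_affine_maps c P)) * 1 \<le> (real (card ?T))\<^sup>2"
  proof (rule count_maps_by_triples)
    show "finite ?T" using P by simp
    fix \<phi> assume \<phi>: "\<phi> \<in> rich_affine_maps c P"
    then show "affine_map \<phi>" by (simp add: rich_affine_maps_def)
    let ?X = "{(x, y, z). (x, y, z) \<in> ?T \<and> (\<phi> x, \<phi> y, \<phi> z) \<in> ?T \<and> det2 (y - x) (z - x) \<noteq> 0}"
    have "?X \<noteq> {}"
    proof
      assume "?X = {}"
      then have "infinite (rich_affine_maps c P)" by (intro infinitely_many_rich[OF \<phi> P]) auto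
      then show False using F by blast
    qed
    moreover have "finite ?X" by (rule finite_subset[of _ ?T]) (use P in auto)
    ultimately have "card ?X \<noteq> 0" using card_0_eq by blast
    then show "1 \<le> real (card ?X)" by simp
  qed simp
  then show ?thesis by (simp add: card_cartesian_product power2_eq_square eval_nat_numeral)
qed

lemma rich_image_card:
  assumes "\<phi> \<in> rich_affine_maps c P" "finite P"
  shows "c * real (card P) \<le> real (card {x\<in>P. \<phi> x \<in> P})"
proof -
  have eq: "\<phi> ` P \<inter> P = \<phi> ` {x\<in>P. \<phi> x \<in> P}" by auto
  have "finite {x\<in>P. \<phi> x \<in> P}" using assms(2) by simp
  then have "card (\<phi> ` P \<inter> P) \<le> card {x\<in>P. \<phi> x \<in> P}" unfolding eq by (rule card_image_le)
  then show ?thesis using assms(1) by (simp add: rich_affine_maps_def)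
qed

text \<open>The radius \<open>4 r\<close> is chosen such that collinear clusters cover at most \<open>c N / 4\<close> points, and \<open>\<delta>\<close>
such that at most \<open>c N / 8\<close> points are crowded. Of the at least \<open>c N\<close> points that a rich map
keeps in \<open>P\<close>, at least \<open>3 c N / 4\<close> remain after removing the crowded points and those with a
crowded image, and at least \<open>c N / 2\<close> of these lie in non-collinear clusters, each of size at
most \<open>K\<close>. For large \<open>N\<close> there are more than \<open>r\<close> lines, because the points have different sign
patterns.\<close>

lemma rich_affine_maps_linear:
  fixes C c :: real
  assumes c: "0 < c" and C: "1 \<le> C"
  shows "\<exists>(A::real) (N0::nat). \<forall>P :: (real^2) set. proper_dimensional C P \<longrightarrow> N0 \<le> card P \<longrightarrow>
    finite (rich_affine_maps c P) \<and> real (card (rich_affine_maps c P)) \<le> A * real (card P)"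
proof -
  define \<delta> where "\<delta> = c / (8 * C\<^sup>2)"
  have \<delta>: "\<delta> > 0" using c C by (simp add: \<delta>_def)
  obtain r :: nat where r: "128 * C\<^sup>2 / c < real r" using reals_Archimedean2 by blast
  have r0: "0 < r"
  proof -
    have "0 < 128 * C\<^sup>2 / c" using c C by (intro divide_pos_pos mult_pos_pos) auto
    then have "0 < real r" using r by linarith
    then show ?thesis by simp
  qed
  obtain K0 :: nat where K0: "\<And>G P. finite G \<Longrightarrow> finite P \<Longrightarrow> (\<And>w x. w \<in> G \<Longrightarrow> x \<in> P \<Longrightarrow> ev w x \<noteq> 0) \<Longrightarrow>
    (\<And>x y. x \<in> P \<Longrightarrow> y \<in> P \<Longrightarrow> x \<noteq> y \<Longrightarrow> sep G x y \<noteq> {}) \<Longrightarrow>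
    real (card (crowded G P (Suc (4 * r - 1)) K0)) \<le> \<delta> * (real (card G))\<^sup>2"
    by (rule few_crowded_points[OF \<delta>, of "4 * r - 1"]) blast
  define K where "K = Suc K0"
  show ?thesis
  proof (intro exI[of _ "2 * real K ^ 5 / c"] exI[of _ "2 ^ Suc r"] allI impI)
    fix P :: "(real^2) set"
    assume proper: "proper_dimensional C P" and N0: "2 ^ Suc r \<le> card P"
    define N where "N = real (card P)"
    have N: "N > 0" 
    proof -
      have "(0::nat) < 2 ^ Suc r" by simp
      then have "0 < card P" using N0 by linarith
      then show ?thesis by (simp add: N_def)
    qed
    have P: "finite P" using proper by (simp add: proper_dimensional_def)
    obtain G where G: "finite G" "real (card G) \<le> C * sqrt N"
      and gen: "\<And>w x. w \<in> G \<Longrightarrow> x \<in> P \<Longrightarrow> ev w x \<noteq> 0"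
      and sep: "\<And>x y. x \<in> P \<Longrightarrow> y \<in> P \<Longrightarrow> x \<noteq> y \<Longrightarrow> sep G x y \<noteq> {}"
      unfolding N_def by (rule separating_forms[OF proper]) blast
    have G2: "(real (card G))\<^sup>2 \<le> C\<^sup>2 * N"
    proof -
      have "(real (card G))\<^sup>2 \<le> (C * sqrt N)\<^sup>2" using G(2) by (intro power_mono) auto
      then show ?thesis using N by (simp add: power_mult_distrib)
    qed
    have rG: "r < 2 * card G"
    proof -
      have "card P \<le> 2 ^ card G" by (rule card_points_le_pow_lines[OF G(1) P gen sep])
      then have "(2::nat) ^ Suc r \<le> 2 ^ card G" using N0 by linarith
      then have "Suc r \<le> card G" by (simp only: power_increasing_iff)
      then show ?thesis by simp
    qed
    define Z where "Z = crowded G P (4 * r) K"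
    have ZP: "Z \<subseteq> P" "finite Z" using P by (auto simp: Z_def crowded_def)
    have Z: "real (card Z) \<le> c * N / 8"
    proof -
      have "Suc (4 * r - 1) = 4 * r" using r0 by simp
      then have "Z \<subseteq> crowded G P (Suc (4 * r - 1)) K0" by (auto simp: Z_def crowded_def K_def)
      moreover have "finite (crowded G P (Suc (4 * r - 1)) K0)" using P by (simp add: crowded_def)
      ultimately have "card Z \<le> card (crowded G P (Suc (4 * r - 1)) K0)" by (rule card_mono[rotated])
      then have "real (card Z) \<le> real (card (crowded G P (Suc (4 * r - 1)) K0))" by simp
      also have "\<dots> \<le> \<delta> * (real (card G))\<^sup>2" by (rule K0[OF G(1) P gen sep])
      also have "\<dots> \<le> \<delta> * (C\<^sup>2 * N)" using G2 \<delta> by (intro mult_left_mono) auto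
      also have "\<dots> = c * N / 8" using C by (simp add: \<delta>_def)
      finally show ?thesis .
    qed
    let ?ball = "\<lambda>x. {y\<in>P. card (sep G x y) < 4 * r}"
    define T where "T = (SIGMA x:P - Z. ?ball x \<times> ?ball x)"
    have finT: "finite T" using P by (simp add: T_def)
    have cT: "real (card T) \<le> N * (real K)\<^sup>2"
    proof -
      have "card T = (\<Sum>x\<in>P - Z. card (?ball x) * card (?ball x))"
        unfolding T_def using P by (subst card_SigmaI) (auto simp: card_cartesian_product)
      also have "\<dots> \<le> (\<Sum>x\<in>P - Z. K * K)"
        by (intro sum_mono mult_le_mono) (auto simp: Z_def crowded_def not_less)
      also have "\<dots> = card (P - Z) * (K * K)" by simp
      also have "\<dots> \<le> card P * (K * K)" using P by (intro mult_le_mono1 card_mono) auto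
      finally have "real (card T) \<le> real (card P * (K * K))" by (rule of_nat_mono)
      then show ?thesis by (simp add: N_def power2_eq_square)
    qed
    define s where "s = c * N / (2 * real K)"
    have s: "s > 0" using c N by (simp add: s_def K_def)
    have main: "finite (rich_affine_maps c P) \<and> real (card (rich_affine_maps c P)) * s \<le> (real (card T))\<^sup>2"
    proof (rule count_maps_by_triples[OF finT s])
      fix \<phi> assume \<phi>: "\<phi> \<in> rich_affine_maps c P"
      then show aff: "affine_map \<phi>" by (simp add: rich_affine_maps_def)
      define Q where "Q = {x\<in>P. \<phi> x \<in> P} - Z - (\<phi> -` Z)"
      have Q: "Q \<subseteq> P" "\<phi> ` Q \<subseteq> P" "Q \<inter> crowded G P (4 * r) K = {}"
        by (auto simp: Q_def Z_def)
      have finQ: "finite Q" using Q(1) P finite_subset by blast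
      have cQ: "real (card Q) \<ge> 3 / 4 * c * N"
      proof -
        have inj: "inj \<phi>" by (rule affine_map_inj[OF aff])
        have fv: "finite (\<phi> -` Z)" using finite_vimageI[OF ZP(2) inj] .
        have cv: "card (\<phi> -` Z) \<le> card Z"
          by (rule card_inj_on_le[of \<phi>]) (use inj ZP(2) in \<open>auto simp: inj_on_def\<close>)
        have "{x\<in>P. \<phi> x \<in> P} \<subseteq> Q \<union> Z \<union> \<phi> -` Z" by (auto simp: Q_def)
        then have "card {x\<in>P. \<phi> x \<in> P} \<le> card (Q \<union> Z \<union> \<phi> -` Z)"
          using finQ ZP(2) fv by (intro card_mono) auto
        also have "\<dots> \<le> card Q + card Z + card Z"
          using card_Un_le[of "Q \<union> Z" "\<phi> -` Z"] card_Un_le[of Q Z] cv by linarith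
        finally have "real (card {x\<in>P. \<phi> x \<in> P}) \<le> real (card Q) + 2 * real (card Z)" by linarith
        then show ?thesis using rich_image_card[OF \<phi> P] Z by (simp add: N_def)
      qed
      define M where "M = {x\<in>Q. \<exists>y\<in>Q. \<exists>z\<in>Q. det2 (y - x) (z - x) \<noteq> 0 \<and>
        card (sep G x y) < 4 * r \<and> card (sep G x z) < 4 * r \<and>
        card (sep G (\<phi> x) (\<phi> y)) < 4 * r \<and> card (sep G (\<phi> x) (\<phi> z)) < 4 * r}"
      have "card Q * r \<le> K * card M * r + 32 * (card G)\<^sup>2"
        unfolding M_def by (rule many_close_triples[OF G(1) P gen sep aff r0 rG Q])
      then have "real (card Q * r) \<le> real (K * card M * r + 32 * (card G)\<^sup>2)" by (rule of_nat_mono)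
      then have "real (card Q) * real r \<le> real K * real (card M) * real r + 32 * (real (card G))\<^sup>2" by simp
      also have "\<dots> \<le> real K * real (card M) * real r + 32 * (C\<^sup>2 * N)" using G2 by simp
      also have "\<dots> \<le> real K * real (card M) * real r + c * N / 4 * real r"
      proof -
        have "128 * C\<^sup>2 \<le> c * real r" using r c by (simp add: field_simps)
        then have "128 * C\<^sup>2 * N \<le> c * real r * N" using N by (intro mult_right_mono) auto
        then show ?thesis by (simp add: algebra_simps)
      qed
      finally have "real (card Q) * real r \<le> (real K * real (card M) + c * N / 4) * real r"
        by (simp add: algebra_simps)
      then have "real (card Q) \<le> real K * real (card M) + c * N / 4" using r0 by simp
      then have "c * N / 2 \<le> real K * real (card M)" using cQ by simp
      then have sM: "s \<le> real (card M)" unfolding s_def by (simp add: K_def field_simps)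
      let ?X = "{(x, y, z). (x, y, z) \<in> T \<and> (\<phi> x, \<phi> y, \<phi> z) \<in> T \<and> det2 (y - x) (z - x) \<noteq> 0}"
      have finX: "finite ?X" by (rule finite_subset[OF _ finT]) auto
      have "M \<subseteq> fst ` ?X"
      proof
        fix x assume "x \<in> M"
        then obtain y z where x: "x \<in> Q" and yz: "y \<in> Q" "z \<in> Q" "det2 (y - x) (z - x) \<noteq> 0"
          "card (sep G x y) < 4 * r" "card (sep G x z) < 4 * r"
          "card (sep G (\<phi> x) (\<phi> y)) < 4 * r" "card (sep G (\<phi> x) (\<phi> z)) < 4 * r"
          unfolding M_def by blast
        have "x \<in> P - Z" "\<phi> x \<in> P - Z" "y \<in> P" "z \<in> P" "\<phi> y \<in> P" "\<phi> z \<in> P"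
          using x yz(1,2) by (auto simp: Q_def)
        then have "(x, y, z) \<in> ?X" using yz by (simp add: T_def)
        then show "x \<in> fst ` ?X" by (rule rev_image_eqI) simp
      qed
      then have "card M \<le> card ?X" using finX surj_card_le by blast
      then show "s \<le> real (card ?X)" using sM by linarith
    qed
    have "real (card (rich_affine_maps c P)) * s \<le> (N * (real K)\<^sup>2)\<^sup>2"
      using main cT by (meson order_trans power_mono of_nat_0_le_iff)
    then have "real (card (rich_affine_maps c P)) \<le> (N * (real K)\<^sup>2)\<^sup>2 / s" using s by (simp add: pos_le_divide_eq)
    also have "\<dots> = 2 * real K ^ 5 / c * N"
      unfolding s_def using N c by (simp add: K_def field_simps power2_eq_square eval_nat_numeral)
    finally show "finite (rich_affine_maps c P) \<and> real (card (rich_affine_maps c P)) \<le> 2 * real K ^ 5 / c * real (card P)"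
      using main by (simp add: N_def)
  qed
qed

theorem theorem2p3:
  fixes C c :: real
  assumes "0 < c" and "c < 1"
  shows "\<exists>(Cstar::real) (N0::nat). \<forall>P :: (real^2) set.
           finite P \<and> proper_dimensional C P \<longrightarrow>
             (N0 \<le> card P \<longrightarrow> finite (rich_affine_maps c P)) \<and>
             (finite (rich_affine_maps c P) \<longrightarrow>
                real (card (rich_affine_maps c P)) \<le> Cstar * real (card P))"
proof -
  have mono: "proper_dimensional (max C 1) P" if "proper_dimensional C P" for P :: "(real^2) set"
  proof -
    have "C * real (card P) powr (1 / real DIM(real^2)) \<le> max C 1 * real (card P) powr (1 / real DIM(real^2))"
      by (intro mult_right_mono) auto
    then show ?thesis using that unfolding proper_dimensional_def by (meson order_trans)
  qed
  have "1 \<le> max C 1" by simp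
  from rich_affine_maps_linear[OF assms(1) this] obtain A :: real and N0 :: nat where
    A: "\<And>P :: (real^2) set. proper_dimensional (max C 1) P \<Longrightarrow> N0 \<le> card P \<Longrightarrow>
      finite (rich_affine_maps c P) \<and> real (card (rich_affine_maps c P)) \<le> A * real (card P)"
    by blast
  show ?thesis
  \<comment> \<open>For \<open>N < N0\<close> points the bound \<open>N^6\<close> is at most
    \<open>N0^5*N\<close>.\<close>
  proof (intro exI[of _ "max A (real N0 ^ 5)"] exI[of _ N0] allI impI, elim conjE)
    fix P :: "(real^2) set" assume P: "finite P" "proper_dimensional C P"
    show "(N0 \<le> card P \<longrightarrow> finite (rich_affine_maps c P)) \<and>
      (finite (rich_affine_maps c P) \<longrightarrow>
         real (card (rich_affine_maps c P)) \<le> max A (real N0 ^ 5) * real (card P))"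
    proof (cases "N0 \<le> card P")
      case True
      have "A * real (card P) \<le> max A (real N0 ^ 5) * real (card P)" by (intro mult_right_mono) auto
      then show ?thesis using A[OF mono[OF P(2)] True] by linarith
    next
      case False
      have "real (card (rich_affine_maps c P)) \<le> max A (real N0 ^ 5) * real (card P)"
        if "finite (rich_affine_maps c P)"
      proof -
        have "real (card (rich_affine_maps c P)) \<le> real (card P) ^ 5 * real (card P)"
          using card_rich_affine_maps_le_pow6[OF P(1) that] by (simp add: eval_nat_numeral algebra_simps)
        also have "\<dots> \<le> max A (real N0 ^ 5) * real (card P)"
        proof (rule mult_right_mono)
          have "real (card P) ^ 5 \<le> real N0 ^ 5" using False by (intro power_mono) auto
          then show "real (card P) ^ 5 \<le> max A (real N0 ^ 5)" by (rule max.coboundedI2)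
        qed simp
        finally show ?thesis .
      qed
      then show ?thesis using False by blast
    qed
  qed
qed

end
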